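(* Let $\ell_0>0$ and $(y_0,y_1)\in C^{0,1}([0,\ell_0])\times L^\infty([0,\ell_0])$ satisfy $y_0(\ell_0)=0$, and let $\ell_\ast=\ell_\ast(\ell_0,y_0,y_1)$ be the size of the domain at the end of the initial branch. Let $T>0$, $\bar\ell_0>0$ and $(\bar y_0,\bar y_1)\in C^1([0,\bar\ell_0])\times C^0([0,\bar\ell_0])$ satisfy $$\bar\ell_0\ge\ell_\ast,\qquad T>2\bar\ell_0,\qquad \bar y_0(\bar\ell_0)=0,\qquad \|\bar y_1+\bar y_0'\|_{L^\infty([0,\bar\ell_0])}^2\le 2\,\kappa(\bar\ell_0).$$ Then there exists a control $u\in C^{0,1}([0,T])$ such that the $C^{0,1}$-solution $(\ell,y)$ on $[0,T]$ of the debonding system with data $(\ell_0,y_0,y_1)$ and control $u$ satisfies $$\ell(T)=\bar\ell_0,\qquad y(T,\cdot)=\bar y_0,\qquad \partial_t y(T,\cdot)=\bar y_1 .$$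
   Context: Fix $0<c_1<c_2$ and a locally Lipschitz function $\kappa:[0,\infty)\to[c_1,c_2]$. Debonding system. Given $\ell_0>0$, $(y_0,y_1)$ on $[0,\ell_0]$ and a control $u$ on $[0,T]$, the unknowns are the front $\ell:[0,T]\to(0,\infty)$ and the displacement $y$ on $\{0\le t\le T,\ 0\le x\le \ell(t)\}$. The equations are $\partial_{tt}^2y-\partial_{xx}^2y=0$ for $0<x<\ell(t)$; $y(t,0)=u(t)$; $y(t,\ell(t))=0$; $y(0,\cdot)=y_0$; $\partial_ty(0,\cdot)=y_1$; together with Griffith's criterion $\ell'\ge0$, $G_{\ell'(t)}(t)\le\kappa(\ell(t))$, $\ell'(t)[G_{\ell'(t)}(t)-\kappa(\ell(t))]=0$, $\ell(0)=\ell_0$, where $G_{\ell'(t)}(t)=\frac12(1-\ell'(t)^2)(\partial_xy(t,\ell(t)))^2$. Solutions are understood through the following equivalent formulation. Put $\tau_\pm(t)=t\pm\ell(t)$ (strictly increasing). There is $f:[-\ell_0,T]\to\mathbb R$ with (1) $f(s)=\frac12\int_0^{-s}(y_0'-y_1)(\sigma)\,d\sigma$ for $s\in[-\ell_0,0]$; $f(s)=u(s)-u(0)-\frac12\int_0^s(y_0'+y_1)(\sigma)\,d\sigma$ for $s\in(0,\ell_0]$, $s\le T$; $f(s)=u(s)+f(\tau_-(\tau_+^{-1}(s)))$ for $s\in(\ell_0,T]$; (2) $\ell(0)=\ell_0$ and $\ell'(t)=\max\Big[\frac{2f'(t-\ell(t))^2-\kappa(\ell(t))}{2f'(t-\ell(t))^2+\kappa(\ell(t))},0\Big]$;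 (3) $y(t,x)=f(t-x)-g(t+x)$, where $g(s)=-u(0)-\frac12\int_0^s(y_0'+y_1)(\sigma)\,d\sigma$ for $0\le s\le\ell_0$ and $g(s)=f(\tau_-(\tau_+^{-1}(s)))$ for $\ell_0<s\le T+\ell(T)$ (i.e. $y(t,x)=u(t+x)-f(t+x)+f(t-x)$). A $C^{0,1}$-solution is one with $\ell,y,f$ Lipschitz; then (2) and all identities between derivatives (including $\partial_ty(T,\cdot)=\bar y_1$) hold almost everywhere. Derivatives in $t$ at $t=T$ are one-sided. Known well-posedness: if $(y_0,y_1)\in C^{0,1}\times L^\infty$, $u\in C^{0,1}([0,T])$, $y_0(0)=u(0)$ and $y_0(\ell_0)=0$, then there is a unique $C^{0,1}$-solution on $[0,T]$. Initial branch. Until the time $t_\ast$ at which $t-\ell(t)=0$, $\ell$ depends only on $(\ell_0,y_0,y_1)$: it solves (a.e.) $\ell(0)=\ell_0$, $\ell'(t)=\max\Big[\frac{\frac12 w^2-\kappa(\ell(t))}{\frac12 w^2+\kappa(\ell(t))},0\Big]$ with $w=(y_1-y_0')(\ell(t)-t)$. Define $t_\ast$ as the time with $\ell(t_\ast)=t_\ast$, and $\ell_\ast:=\ell(t_\ast)=t_\ast$. *)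

theory Defs
  imports "HOL-Analysis.Analysis" "HOL-Probability.Essential_Supremum"
begin

definition C01_on :: "'a::metric_space set \<Rightarrow> ('a \<Rightarrow> 'b::metric_space) \<Rightarrow> bool" where
  "C01_on S f \<longleftrightarrow> (\<exists>L. L-lipschitz_on S f)"

text \<open>
  Derivative of a function given on the interval \<open>{a..b}\<close>: one-sided at the endpoints and
  independent of the values outside \<open>{a..b}\<close>. It is unspecified where the function is not
  differentiable; for a Lipschitz function this is a null set, which is irrelevant to the
  integrals below.
\<close>

definition D_on :: "real \<Rightarrow> real \<Rightarrow> (real \<Rightarrow> real) \<Rightarrow> real \<Rightarrow> real" where
  "D_on a b f x = vector_derivative f (at x within {a..b})"

definition C1_on :: "real \<Rightarrow> real \<Rightarrow> (real \<Rightarrow> real) \<Rightarrow> bool" where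
  "C1_on a b f \<longleftrightarrow>
     (\<forall>x\<in>{a..b}. f differentiable (at x within {a..b})) \<and> continuous_on {a..b} (D_on a b f)"

definition Linf_norm :: "real \<Rightarrow> real \<Rightarrow> (real \<Rightarrow> real) \<Rightarrow> ereal" where
  "Linf_norm a b f = esssup (lebesgue_on {a..b}) (\<lambda>x. ereal \<bar>f x\<bar>)"

definition Linf_on :: "real \<Rightarrow> real \<Rightarrow> (real \<Rightarrow> real) \<Rightarrow> bool" where
  "Linf_on a b f \<longleftrightarrow> f \<in> borel_measurable (lebesgue_on {a..b}) \<and> Linf_norm a b f < \<infinity>"

text \<open>
  The map \<open>s \<mapsto> \<tau>\<^sub>-(\<tau>\<^sub>+\<^sup>-\<^sup>1(s))\<close> with \<open>\<tau>\<^sub>\<plusminus>(t) = t \<plusminus> \<ell>(t)\<close> on \<open>[0,T]\<close>. For a front solving the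
  equation in \<open>C01_solution\<close>, \<open>\<tau>\<^sub>+\<close> is strictly increasing, and the map is only used for
  \<open>s\<close> in the range of \<open>\<tau>\<^sub>+\<close>.
\<close>

definition reflect :: "real \<Rightarrow> (real \<Rightarrow> real) \<Rightarrow> real \<Rightarrow> real" where
  "reflect T l s = (let t = the_inv_into {0..T} (\<lambda>t. t + l t) s in t - l t)"

text \<open>
  \<open>C01_solution \<kappa> l0 y0 y1 T u l y\<close>: the pair \<open>(l, y)\<close> is a Lipschitz solution on \<open>[0,T]\<close> of the
  debonding system with data \<open>(l0, y0, y1)\<close> and control \<open>u\<close>, in d'Alembert form
  \<open>y(t,x) = f(t-x) - g(t+x)\<close>. The equation for the front includes that, for almost
  every \<open>t\<close>, the function \<open>f\<close> is differentiable at \<open>t - l t\<close>. The values of \<open>f\<close>, \<open>g\<close>, \<open>l\<close>,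
  \<open>y\<close> outside their domains play no role.
\<close>

definition C01_solution ::
  "(real \<Rightarrow> real) \<Rightarrow> real \<Rightarrow> (real \<Rightarrow> real) \<Rightarrow> (real \<Rightarrow> real) \<Rightarrow> real \<Rightarrow> (real \<Rightarrow> real) \<Rightarrow>
   (real \<Rightarrow> real) \<Rightarrow> (real \<Rightarrow> real \<Rightarrow> real) \<Rightarrow> bool" where
  "C01_solution \<kappa> l0 y0 y1 T u l y \<longleftrightarrow>
     (\<forall>t\<in>{0..T}. 0 < l t) \<and>
     C01_on {0..T} l \<and>
     C01_on {(t, x). 0 \<le> t \<and> t \<le> T \<and> 0 \<le> x \<and> x \<le> l t} (\<lambda>(t, x). y t x) \<and>
     (\<exists>f g.
        C01_on {-l0..T} f \<and>
        (\<forall>s\<in>{-l0..0}. f s = 1/2 * integral {0..-s} (\<lambda>\<sigma>. D_on 0 l0 y0 \<sigma> - y1 \<sigma>)) \<and>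
        (\<forall>s\<in>{0<..l0}. s \<le> T \<longrightarrow>
           f s = u s - u 0 - 1/2 * integral {0..s} (\<lambda>\<sigma>. D_on 0 l0 y0 \<sigma> + y1 \<sigma>)) \<and>
        (\<forall>s\<in>{l0<..T}. f s = u s + f (reflect T l s)) \<and>
        l 0 = l0 \<and>
        (AE t\<in>{0..T} in lebesgue. \<exists>d.
           (f has_real_derivative d) (at (t - l t) within {-l0..T}) \<and>
           (l has_real_derivative max ((2 * d\<^sup>2 - \<kappa> (l t)) / (2 * d\<^sup>2 + \<kappa> (l t))) 0)
             (at t within {0..T})) \<and>
        (\<forall>s\<in>{0..l0}. g s = - u 0 - 1/2 * integral {0..s} (\<lambda>\<sigma>. D_on 0 l0 y0 \<sigma> + y1 \<sigma>)) \<and>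
        (\<forall>s\<in>{l0<..T + l T}. g s = f (reflect T l s)) \<and>
        (\<forall>t\<in>{0..T}. \<forall>x\<in>{0..l t}. y t x = f (t - x) - g (t + x)))"

text \<open>
  \<open>initial_branch_end \<kappa> l0 y0 y1 s\<close>: the initial branch determined by \<open>(l0, y0, y1)\<close> meets the
  characteristic \<open>t = x\<close> at \<open>t = s\<close>, so \<open>s\<close> is both the time \<open>t\<^sub>*\<close> and the length \<open>\<ell>\<^sub>* = \<ell>(t\<^sub>*)\<close>.
\<close>

definition initial_branch_end ::
  "(real \<Rightarrow> real) \<Rightarrow> real \<Rightarrow> (real \<Rightarrow> real) \<Rightarrow> (real \<Rightarrow> real) \<Rightarrow> real \<Rightarrow> bool" where
  "initial_branch_end \<kappa> l0 y0 y1 s \<longleftrightarrow>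
     0 < s \<and>
     (\<exists>l. C01_on {0..s} l \<and> l 0 = l0 \<and> l s = s \<and>
        (AE t\<in>{0..s} in lebesgue. \<exists>d.
           (y0 has_real_derivative d) (at (l t - t) within {0..l0}) \<and>
           (let w = y1 (l t - t) - d in
            (l has_real_derivative max ((1/2 * w\<^sup>2 - \<kappa> (l t)) / (1/2 * w\<^sup>2 + \<kappa> (l t))) 0)
              (at t within {0..s}))))"

end

theory Submission
  imports Defs
begin

text \<open>
  In the variable \<open>s = t - l t\<close> the front equation becomes
  \<open>\<lambda>' = max (f'\<^sup>2 / \<kappa> \<lambda> - 1/2) 0\<close>. Its right-hand side is Lipschitz in \<open>\<lambda>\<close>, so \<open>f\<close> up to \<open>a\<close>
  determines the front as long as \<open>t - l t \<le> a\<close>; as the reflected characteristics are delayed by at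
  least \<open>2 l\<^sub>0\<close>, the control determines \<open>f\<close> and the front step by step, and the solution is unique.
  Conversely, \<open>f\<close> can be prescribed freely on \<open>[0,T]\<close>, and the control is then read off.
  On \<open>[0, T - 2 b]\<close>, \<open>b\<close> the target length, choose \<open>f\<close> such that the front moves linearly from the
  end of the initial branch to \<open>b\<close>. On \<open>[T - 2 b, T]\<close> the function \<open>f\<close> is forced by the target state,
  up to a constant that is fixed by continuity and cancels in \<open>y\<close>; the bound on the target state says
  exactly that the front rests at \<open>b\<close> meanwhile.
\<close>

text \<open>All functions are merely Lipschitz, so the equations hold almost everywhere, and the
  exceptional sets live in two variables: times \<open>t\<close> for the front, characteristics
  \<open>s = t - l t\<close> for \<open>f\<close>. From \<open>t\<close> to \<open>s\<close> null
  sets are carried by a Lipschitz map. The way back is needed on the initial branch, where the data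
  prescribe bad points in \<open>s\<close>; there only a pointwise bound below 1 on the speed is at
  hand, and a nonvanishing derivative has to do.

  The number \<open>2 b\<close> is the time that a signal needs to cross the resting domain twice.
  The values of \<open>f\<close> on \<open>[T - 2 b, T - b]\<close> reach the front during
  \<open>[T - b, T]\<close> and could move it, so the bound concerns the combination of target data
  that they carry; the values on \<open>[T - b, T]\<close> are still on their way at time
  \<open>T\<close>. As \<open>T > 2 b\<close> is strict, an interval of positive length in
  \<open>s\<close> remains for the transport of the front. A front never retreats, so the target
  cannot be shorter than the end of the initial branch.\<close>

section \<open>Lipschitz functions and their derivatives almost everywhere\<close>

text \<open>The increase of \<open>\<phi>\<close> over the exceptional set is absorbed by \<open>L\<close> times the measure of an open
  superset \<open>U\<close>, which makes the estimate local and accessible to bisection.\<close>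
lemma lipschitz_AE_deriv_nonpos:
  fixes \<phi> :: "real \<Rightarrow> real"
  assumes lip: "L-lipschitz_on {a..b} \<phi>" and N: "negligible N" and "a \<le> b"
    and der: "\<And>t. t \<in> {a<..<b} - N \<Longrightarrow> \<exists>d\<le>0. (\<phi> has_real_derivative d) (at t)"
  shows "\<phi> b \<le> \<phi> a"
proof -
  have L0: "0 \<le> L" using lip by (rule lipschitz_on_nonneg)
  \<comment> \<open>No derivative is assumed at the endpoints, so they count as exceptional points
    and are covered by \<open>U\<close> as well.\<close>
  define N' where "N' = N \<union> {a, b}"
  have N': "negligible N'" unfolding N'_def using N by simp
  have *: "\<phi> b - \<phi> a \<le> e * (b - a) + L * e" if "e > 0" for e
  proof -
    have "N' \<in> sets lebesgue" using N' negligible_imp_sets by blast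
    then obtain U where U: "open U" "N' \<subseteq> U" "U - N' \<in> lmeasurable" "emeasure lebesgue (U - N') < ennreal e"
      using sets_lebesgue_outer_open \<open>e > 0\<close> by metis
    have Ueq: "U = (U - N') \<union> N'" using U by auto
    have Um: "U \<in> lmeasurable"
      by (metis N' Ueq U(3) fmeasurable.Un negligible_imp_measurable)
    have "measure lebesgue U = measure lebesgue (U - N')"
      using N' by (metis measure_Diff_null_set Um fmeasurableD negligible_iff_null_sets)
    also have "\<dots> < e" using U(4) \<open>e > 0\<close>
      by (metis U(3) emeasure_eq_measure2 ennreal_less_iff measure_nonneg)
    finally have Ue: "measure lebesgue U < e" .
    define m where "m u v = measure lebesgue (U \<inter> {u<..v})" for u v
    have Ium: "U \<inter> {u<..v} \<in> lmeasurable" for u v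
      using Um by (intro fmeasurable_Int_fmeasurable) auto
    define P where "P u v \<longleftrightarrow> (a \<le> u \<and> v \<le> b \<longrightarrow> \<phi> v - \<phi> u \<le> e * (v - u) + L * m u v)" for u v
    have "P a b"
      using \<open>a \<le> b\<close>
    proof (induction rule: Bolzano)
      case (trans u v w)
      have "U \<inter> {u<..w} = (U \<inter> {u<..v}) \<union> (U \<inter> {v<..w})" using trans by auto
      then have "m u w = m u v + m v w"
        unfolding m_def using Ium by (simp add: measure_Un_AE disjoint_iff)
      then show ?case using trans unfolding P_def by (auto simp: algebra_simps)
    next
      case (local x)
      show ?case
      proof (cases "x \<in> N'")
        case True
        then obtain d where d: "d > 0" "ball x d \<subseteq> U" using U open_contains_ball by blast
        have "P u v" if "u \<le> x \<and> x \<le> v \<and> v - u < d" for u v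
        proof -
          have "{u<..v} \<subseteq> U" using d that by (force simp: dist_real_def)
          then have "m u v = v - u" using that unfolding m_def by (simp add: Int_absorb1)
          moreover have "\<phi> v - \<phi> u \<le> L * (v - u)" if "a \<le> u" "v \<le> b"
            using lipschitz_onD[OF lip, of v u] that \<open>u \<le> x \<and> x \<le> v \<and> v - u < d\<close> by (auto simp: dist_real_def)
          ultimately show ?thesis unfolding P_def using that \<open>e > 0\<close> by (auto intro: add_increasing)
        qed
        then show ?thesis using d by blast
      next
        case False
        then have "x \<in> {a<..<b} - N" using local unfolding N'_def by auto
        then obtain D where D: "D \<le> 0" "(\<phi> has_real_derivative D) (at x)" using der by blast
        then have "(\<phi> has_derivative (\<lambda>h. h * D)) (at x)" by (simp add: has_field_derivative_def mult_commute_abs)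
        then obtain d where d: "d > 0" "\<And>y. norm (y - x) < d \<Longrightarrow> norm (\<phi> y - \<phi> x - (y - x) * D) \<le> e * norm (y - x)"
          unfolding has_derivative_at_alt using \<open>e > 0\<close> by blast
        have "P u v" if "u \<le> x \<and> x \<le> v \<and> v - u < d" for u v
        proof -
          have 1: "\<phi> v - \<phi> x \<le> e * (v - x)"
          proof -
            have "\<bar>\<phi> v - \<phi> x - (v - x) * D\<bar> \<le> e * (v - x)" using d(2)[of v] that by auto
            moreover have "(v - x) * D \<le> 0" using D that by (simp add: mult_nonneg_nonpos)
            ultimately show ?thesis by linarith
          qed
          have 2: "\<phi> x - \<phi> u \<le> e * (x - u)"
          proof -
            have "\<bar>\<phi> u - \<phi> x - (u - x) * D\<bar> \<le> e * (x - u)" using d(2)[of u] that by auto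
            moreover have "(u - x) * D \<ge> 0" using D that by (simp add: mult_nonpos_nonpos)
            ultimately show ?thesis by linarith
          qed
          have "\<phi> v - \<phi> u \<le> e * (v - u)" using 1 2 by (simp add: algebra_simps)
          moreover have "0 \<le> L * m u v" using L0 by (simp add: m_def)
          ultimately show ?thesis unfolding P_def by linarith
        qed
        then show ?thesis using d by blast
      qed
    qed
    then have "\<phi> b - \<phi> a \<le> e * (b - a) + L * m a b" by (auto simp: P_def)
    also have "m a b \<le> measure lebesgue U" unfolding m_def by (rule measure_mono_fmeasurable) (use Um in auto)
    finally show ?thesis using Ue L0 by (smt (verit) mult_left_mono)
  qed
  have "\<phi> b - \<phi> a \<le> 0 + e" if "e > 0" for e
  proof -
    have 1: "b - a + L + 1 > 0" using L0 \<open>a \<le> b\<close> by simp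
    have "\<phi> b - \<phi> a \<le> (e / (b - a + L + 1)) * (b - a) + L * (e / (b - a + L + 1))"
      using *[of "e / (b - a + L + 1)"] that 1 by simp
    also have "\<dots> = e * ((b - a + L) / (b - a + L + 1))" by (simp add: add_divide_distrib diff_divide_distrib algebra_simps)
    also have "\<dots> \<le> e * 1" using 1 that by (intro mult_left_mono) auto
    finally show ?thesis by simp
  qed
  then have "\<phi> b - \<phi> a \<le> 0" by (rule field_le_epsilon)
  then show ?thesis by simp
qed

text \<open>The function \<open>c * t - \<phi> t\<close> is nonincreasing. With \<open>c > 0\<close>
  this becomes the lower slope bound that makes \<open>t - l t\<close> invertible with a Lipschitz
  inverse.\<close>

lemma lipschitz_AE_deriv_ge:
  fixes \<phi> :: "real \<Rightarrow> real"
  assumes lip: "L-lipschitz_on {a..b} \<phi>" and N: "negligible N"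
    and der: "\<And>t. t \<in> {a<..<b} - N \<Longrightarrow> \<exists>d\<ge>c. (\<phi> has_real_derivative d) (at t)"
    and xy: "a \<le> x" "x \<le> y" "y \<le> b"
  shows "c * (y - x) \<le> \<phi> y - \<phi> x"
proof -
  have l: "(\<bar>c\<bar> * 1 + L)-lipschitz_on {x..y} (\<lambda>t. c * t - \<phi> t)"
    by (intro lipschitz_on_diff lipschitz_on_cmult_real lipschitz_on_id lipschitz_on_subset[OF lip])
       (use xy in auto)
  have "c * y - \<phi> y \<le> c * x - \<phi> x"
  proof (rule lipschitz_AE_deriv_nonpos[OF l N])
    fix t assume "t \<in> {x<..<y} - N"
    then have "t \<in> {a<..<b} - N" using xy by auto
    then obtain d where "d \<ge> c" "(\<phi> has_real_derivative d) (at t)" using der by blast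
    then show "\<exists>d\<le>0. ((\<lambda>t. c * t - \<phi> t) has_real_derivative d) (at t)"
      by (intro exI[of _ "c - d"]) (auto intro!: derivative_eq_intros)
  qed (use xy in auto)
  then show ?thesis by (simp add: algebra_simps)
qed

lemma lipschitz_AE_deriv_zero:
  fixes \<phi> :: "real \<Rightarrow> real"
  assumes lip: "L-lipschitz_on {a..b} \<phi>" and N: "negligible N"
    and der: "\<And>t. t \<in> {a<..<b} - N \<Longrightarrow> (\<phi> has_real_derivative 0) (at t)"
    and x: "x \<in> {a..b}"
  shows "\<phi> x = \<phi> a"
proof -
  have "0 * (x - a) \<le> \<phi> x - \<phi> a"
    by (rule lipschitz_AE_deriv_ge[OF lip N]) (use der x in \<open>auto simp del: mult_zero_left\<close>)
  moreover have "\<phi> x \<le> \<phi> a"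
    by (rule lipschitz_AE_deriv_nonpos[OF lipschitz_on_subset[OF lip] N]) (use der x in auto)
  ultimately show ?thesis by simp
qed

lemma negligible_lipschitz_image:
  fixes \<phi> :: "real \<Rightarrow> real"
  assumes lip: "L-lipschitz_on S \<phi>" and N: "negligible N" and sub: "N \<subseteq> S"
  shows "negligible (\<phi> ` N)"
proof (rule negligible_locally_Lipschitz_image[OF _ N])
  fix x assume "x \<in> N"
  then show "\<exists>T B. open T \<and> x \<in> T \<and> (\<forall>y\<in>N \<inter> T. norm (\<phi> y - \<phi> x) \<le> B * norm (y - x))"
    using sub lipschitz_on_normD[OF lip] by (intro exI[of _ UNIV] exI[of _ L]) auto
qed auto

text \<open>\<open>E\<close> is a countable union of pieces on which \<open>\<theta>\<close> has a Lipschitz inverse.\<close>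
lemma negligible_deriv_nonzero_preimage:
  fixes \<theta> :: "real \<Rightarrow> real"
  assumes der: "\<And>t. t \<in> E \<Longrightarrow> \<exists>d. d \<noteq> 0 \<and> (\<theta> has_real_derivative d) (at t)"
    and neg: "negligible (\<theta> ` E)"
  shows "negligible E"
proof -
  define c where "c n = inverse (real (Suc n))" for n
  \<comment> \<open>Points at which \<open>\<theta>\<close> shrinks distances at most by the factor
    \<open>1 / Suc n\<close>, tested at scale \<open>c n\<close>. The cells indexed by
    \<open>k\<close> have length \<open>c n\<close>, so any two points of one piece are close enough
    for the test.\<close>
  define A where "A n k = {x\<in>E. x \<in> {of_int k * c n ..< (of_int k + 1) * c n} \<and>
      (\<forall>y. \<bar>y - x\<bar> < c n \<longrightarrow> \<bar>y - x\<bar> \<le> real (Suc n) * \<bar>\<theta> y - \<theta> x\<bar>)}" for n and k :: int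
  have c0: "c n > 0" for n by (simp add: c_def)
  have neg1: "negligible (A n k)" for n k
  proof -
    have close: "\<bar>y - x\<bar> < c n" if "x \<in> A n k" "y \<in> A n k" for x y
      using that by (auto simp: A_def algebra_simps)
    have ineq: "\<bar>y - x\<bar> \<le> real (Suc n) * \<bar>\<theta> y - \<theta> x\<bar>" if "x \<in> A n k" "y \<in> A n k" for x y
      using close[OF that] that unfolding A_def by blast
    have inj: "inj_on \<theta> (A n k)"
      by (rule inj_onI) (use ineq in force)
    have "negligible (\<theta> ` A n k)" by (rule negligible_subset[OF neg]) (auto simp: A_def)
    then have "negligible (the_inv_into (A n k) \<theta> ` \<theta> ` A n k)"
    proof (rule negligible_lipschitz_image[rotated])
      show "(real (Suc n))-lipschitz_on (\<theta> ` A n k) (the_inv_into (A n k) \<theta>)"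
        by (rule lipschitz_onI) (auto simp: the_inv_into_f_f[OF inj] dist_real_def simp del: of_nat_Suc intro!: ineq)
    qed auto
    moreover have "the_inv_into (A n k) \<theta> ` \<theta> ` A n k = A n k"
      using inj by (force simp: the_inv_into_f_f image_iff)
    ultimately show ?thesis by simp
  qed
  have "E \<subseteq> (\<Union>n. \<Union>k. A n k)"
  proof
    fix x assume x: "x \<in> E"
    then obtain d where d: "d \<noteq> 0" "(\<theta> has_real_derivative d) (at x)" using der by blast
    then have "(\<theta> has_derivative (\<lambda>h. h * d)) (at x)" by (simp add: has_field_derivative_def mult_commute_abs)
    then obtain r where r: "r > 0" "\<And>y. norm (y - x) < r \<Longrightarrow> norm (\<theta> y - \<theta> x - (y - x) * d) \<le> \<bar>d\<bar>/2 * norm (y - x)"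
      unfolding has_derivative_at_alt using d by (metis half_gt_zero zero_less_abs_iff)
    \<comment> \<open>One \<open>n\<close> serves two purposes: \<open>c n\<close> is below the
      radius \<open>r\<close> of the linear approximation and below the slope
      \<open>\<bar>d\<bar>/2\<close> that it guarantees.\<close>
    obtain n where n: "inverse (real (Suc n)) < min r (\<bar>d\<bar>/2)"
      using reals_Archimedean[of "min r (\<bar>d\<bar>/2)"] r d by auto
    have "\<bar>y - x\<bar> \<le> real (Suc n) * \<bar>\<theta> y - \<theta> x\<bar>" if "\<bar>y - x\<bar> < c n" for y
    proof -
      have "\<bar>\<theta> y - \<theta> x - (y - x) * d\<bar> \<le> \<bar>d\<bar>/2 * \<bar>y - x\<bar>" using r(2)[of y] that n by (auto simp: c_def)
      moreover have "\<bar>(y - x) * d\<bar> = \<bar>d\<bar> * \<bar>y - x\<bar>" by (simp add: abs_mult)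
      ultimately have "\<bar>d\<bar>/2 * \<bar>y - x\<bar> \<le> \<bar>\<theta> y - \<theta> x\<bar>" by linarith
      moreover have "c n * \<bar>y - x\<bar> \<le> \<bar>d\<bar>/2 * \<bar>y - x\<bar>" using n by (intro mult_right_mono) (auto simp: c_def)
      ultimately have "c n * \<bar>y - x\<bar> \<le> \<bar>\<theta> y - \<theta> x\<bar>" by linarith
      then show ?thesis by (simp add: c_def field_simps)
    qed
    moreover have "x \<in> {of_int \<lfloor>x / c n\<rfloor> * c n ..< (of_int \<lfloor>x / c n\<rfloor> + 1) * c n}"
    proof -
      have "of_int \<lfloor>x / c n\<rfloor> * c n \<le> x" using c0[of n] by (metis pos_le_divide_eq of_int_floor_le)
      moreover have "x < (of_int \<lfloor>x / c n\<rfloor> + 1) * c n"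
        using c0[of n] by (metis pos_divide_less_eq floor_correct of_int_1 of_int_add)
      ultimately show ?thesis by simp
    qed
    ultimately have "x \<in> A n \<lfloor>x / c n\<rfloor>" using x by (simp add: A_def)
    then show "x \<in> (\<Union>n. \<Union>k. A n k)" by blast
  qed
  moreover have "negligible (\<Union>n. \<Union>k. A n k)"
    by (intro negligible_countable_Union) (auto intro!: neg1 negligible_countable_Union)
  ultimately show ?thesis using negligible_subset by blast
qed

lemma lipschitz_on_mult_bounded:
  fixes f g :: "real \<Rightarrow> real"
  assumes f: "L-lipschitz_on S f" and g: "M-lipschitz_on S g"
    and A: "\<And>x. x \<in> S \<Longrightarrow> \<bar>f x\<bar> \<le> A" and B: "\<And>x. x \<in> S \<Longrightarrow> \<bar>g x\<bar> \<le> B"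
    and "0 \<le> A" "0 \<le> B"
  shows "(A * M + B * L)-lipschitz_on S (\<lambda>x. f x * g x)"
proof (rule lipschitz_onI)
  have 0: "0 \<le> L" "0 \<le> M" using f g lipschitz_on_nonneg by auto
  then show "0 \<le> A * M + B * L" using assms by simp
  fix x y assume xy: "x \<in> S" "y \<in> S"
  have "f x * g x - f y * g y = f x * (g x - g y) + g y * (f x - f y)" by (simp add: algebra_simps)
  then have "\<bar>f x * g x - f y * g y\<bar> \<le> \<bar>f x\<bar> * \<bar>g x - g y\<bar> + \<bar>g y\<bar> * \<bar>f x - f y\<bar>"
    by (metis abs_mult abs_triangle_ineq)
  also have "\<dots> \<le> A * (M * \<bar>x - y\<bar>) + B * (L * \<bar>x - y\<bar>)"
    using lipschitz_onD[OF f xy] lipschitz_onD[OF g xy] A[OF xy(1)] B[OF xy(2)] assms(5,6)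
    by (intro add_mono mult_mono) (auto simp: dist_real_def)
  finally show "dist (f x * g x) (f y * g y) \<le> (A * M + B * L) * dist x y"
    by (simp add: dist_real_def algebra_simps)
qed

lemma lipschitz_on_real_bounded:
  fixes f :: "real \<Rightarrow> real"
  assumes "L-lipschitz_on {a..b} f"
  obtains B where "B \<ge> 0" "\<And>x. x \<in> {a..b} \<Longrightarrow> \<bar>f x\<bar> \<le> B"
proof -
  have "bounded (f ` {a..b})"
    using lipschitz_on_continuous_on[OF assms] compact_continuous_image compact_imp_bounded by blast
  then obtain B where "\<And>x. x \<in> {a..b} \<Longrightarrow> \<bar>f x\<bar> \<le> B" unfolding bounded_iff by fastforce
  then have "\<And>x. x \<in> {a..b} \<Longrightarrow> \<bar>f x\<bar> \<le> \<bar>B\<bar>" by fastforce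
  then show ?thesis using that[of "\<bar>B\<bar>"] by auto
qed

lemma C1_imp_lipschitz:
  fixes f f' :: "real \<Rightarrow> real"
  assumes der: "\<And>x. x \<in> {a..b} \<Longrightarrow> (f has_real_derivative f' x) (at x within {a..b})"
    and cont: "continuous_on {a..b} f'"
  shows "\<exists>L. L-lipschitz_on {a..b} f"
proof -
  have "bounded (f' ` {a..b})" using cont compact_continuous_image compact_imp_bounded by blast
  then obtain B where B: "\<And>x. x \<in> {a..b} \<Longrightarrow> \<bar>f' x\<bar> \<le> B" unfolding bounded_iff by fastforce
  have "\<bar>B\<bar>-lipschitz_on {a..b} f"
  proof (rule bounded_derivative_imp_lipschitz)
    show "(f has_derivative (\<lambda>h. f' x * h)) (at x within {a..b})" if "x \<in> {a..b}" for x
      using der[OF that] by (simp add: has_field_derivative_def)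
    show "onorm (\<lambda>h. f' x * h) \<le> \<bar>B\<bar>" if "x \<in> {a..b}" for x
      using B[OF that] by (intro onorm_bound) (auto simp: abs_mult intro!: mult_right_mono)
  qed auto
  then show ?thesis by blast
qed

text \<open>The weight \<open>exp (- 2 K s)\<close> makes \<open>p\<^sup>2\<close> nonincreasing.\<close>
lemma gronwall_AE_zero:
  fixes p :: "real \<Rightarrow> real"
  assumes lip: "L-lipschitz_on {a..b} p" and N: "negligible N"
    and der: "\<And>s. s \<in> {a<..<b} - N \<Longrightarrow> \<exists>d. (p has_real_derivative d) (at s) \<and> \<bar>d\<bar> \<le> K * \<bar>p s\<bar>"
    and "p a = 0" "x \<in> {a..b}"
  shows "p x = 0"
proof -
  define e where "e s = exp (- (2 * K * s))" for s
  have de: "(e has_real_derivative (- (2 * K) * e s)) (at s within S)" for s S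
    unfolding e_def by (auto intro!: derivative_eq_intros)
  obtain M where e: "M-lipschitz_on {a..b} e"
  proof -
    have "continuous_on {a..b} (\<lambda>s. - (2 * K) * e s)" unfolding e_def by (intro continuous_intros)
    then show ?thesis using C1_imp_lipschitz[of a b e, OF de] that by blast
  qed
  obtain B where B: "B \<ge> 0" "\<And>x. x \<in> {a..b} \<Longrightarrow> \<bar>p x\<bar> \<le> B" using lipschitz_on_real_bounded[OF lip] by blast
  obtain C where C: "C \<ge> 0" "\<And>x. x \<in> {a..b} \<Longrightarrow> \<bar>e x\<bar> \<le> C" using lipschitz_on_real_bounded[OF e] by blast
  have l1: "(B * L + B * L)-lipschitz_on {a..b} (\<lambda>x. p x * p x)"
    by (rule lipschitz_on_mult_bounded[OF lip lip]) (use B in auto)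
  have l2: "(B * B * M + C * (B * L + B * L))-lipschitz_on {a..b} (\<lambda>x. p x * p x * e x)"
  proof (rule lipschitz_on_mult_bounded[OF l1 e])
    show "\<bar>p x * p x\<bar> \<le> B * B" if "x \<in> {a..b}" for x
      unfolding abs_mult using B(1) B(2)[OF that] by (intro mult_mono) auto
  qed (use B C in auto)
  have "p x * p x * e x \<le> p a * p a * e a"
  proof (rule lipschitz_AE_deriv_nonpos[OF lipschitz_on_subset[OF l2] N])
    fix t assume "t \<in> {a<..<x} - N"
    then have "t \<in> {a<..<b} - N" using \<open>x \<in> {a..b}\<close> by auto
    then obtain d where d: "(p has_real_derivative d) (at t)" "\<bar>d\<bar> \<le> K * \<bar>p t\<bar>" using der by blast
    have "((\<lambda>x. p x * p x * e x) has_real_derivative (2 * e t * (p t * d - K * (p t * p t)))) (at t)"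
      by (auto intro!: derivative_eq_intros d de simp: algebra_simps)
    moreover have "p t * d \<le> K * (p t * p t)"
    proof -
      have "p t * d \<le> \<bar>p t\<bar> * \<bar>d\<bar>" by (metis abs_ge_self abs_mult)
      also have "\<dots> \<le> \<bar>p t\<bar> * (K * \<bar>p t\<bar>)" using d by (intro mult_left_mono) auto
      also have "\<dots> = K * (p t * p t)" by (simp add: algebra_simps)
      finally show ?thesis .
    qed
    then have "2 * e t * (p t * d - K * (p t * p t)) \<le> 0"
      by (intro mult_nonneg_nonpos) (auto simp: e_def)
    ultimately show "\<exists>d\<le>0. ((\<lambda>x. p x * p x * e x) has_real_derivative d) (at t)" by blast
  qed (use \<open>x \<in> {a..b}\<close> in auto)
  then have "p x * p x * e x \<le> 0" using \<open>p a = 0\<close> by simp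
  then have "p x * p x \<le> 0" by (simp add: e_def mult_le_0_iff)
  then show ?thesis by (smt (verit) not_real_square_gt_zero)
qed

section \<open>Differentiation of integrals and integration of derivatives almost everywhere\<close>

lemma indefinite_integral_deriv_AE:
  fixes h :: "real \<Rightarrow> real"
  assumes h: "h integrable_on {a..b}"
  obtains N where "negligible N"
    "\<And>x. x \<in> {a<..<b} - N \<Longrightarrow> ((\<lambda>x. integral {a..x} h) has_real_derivative h x) (at x)"
proof -
  \<comment> \<open>The extension by zero is integrable on every interval, as the one-sided
    differentiation result asks; around an interior point it agrees with \<open>h\<close>.\<close>
  define k where "k x = (if x \<in> {a..b} then h x else 0)" for x
  have kU: "k integrable_on UNIV"
    unfolding k_def using h by (rule iffD2[OF integrable_restrict_UNIV])
  have k: "k integrable_on {u..v}" for u v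
    using integrable_on_subcbox[OF kU, of u v] by simp
  have k': "(\<lambda>x. k (- x)) integrable_on {u..v}" for u v
    using k[of "-v" "-u"] Henstock_Kurzweil_Integration.integrable_reflect_real[where f = k and a = "-v" and b = "-u"] by simp
  obtain N1 where N1: "negligible N1"
    "\<And>x e. \<lbrakk>x \<notin> N1; 0 < e\<rbrakk> \<Longrightarrow> \<exists>d>0. \<forall>h. 0 < h \<and> h < d \<longrightarrow> \<bar>integral {x..x + h} k / h - k x\<bar> < e"
    using integrable_ccontinuous_explicit[of k] k by (auto simp: divide_inverse mult.commute)
  \<comment> \<open>Right-hand quotients for the reflected integrand are left-hand quotients for
    \<open>k\<close>, which gives the two-sided derivative.\<close>
  obtain N2 where N2: "negligible N2"
    "\<And>x e. \<lbrakk>x \<notin> N2; 0 < e\<rbrakk> \<Longrightarrow> \<exists>d>0. \<forall>h. 0 < h \<and> h < d \<longrightarrow> \<bar>integral {x..x + h} (\<lambda>x. k (- x)) / h - k (- x)\<bar> < e"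
    using integrable_ccontinuous_explicit[of "\<lambda>x. k (- x)"] k' by (auto simp: divide_inverse mult.commute)
  define N where "N = N1 \<union> uminus ` N2"
  have "negligible (uminus ` N2)"
    by (rule negligible_lipschitz_image[of 1 UNIV, OF _ N2(1)]) (auto intro!: lipschitz_onI simp: dist_real_def)
  then have N: "negligible N" using N1 by (simp add: N_def)
  have "((\<lambda>x. integral {a..x} h) has_real_derivative h x) (at x)" if x: "x \<in> {a<..<b} - N" for x
    unfolding DERIV_def LIM_eq
  proof (intro allI impI)
    fix r :: real assume r: "r > 0"
    have xN: "x \<notin> N1" "- x \<notin> N2" using x unfolding N_def by force+
    obtain d1 where d1: "d1 > 0" "\<And>h. 0 < h \<Longrightarrow> h < d1 \<Longrightarrow> \<bar>integral {x..x + h} k / h - k x\<bar> < r"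
      using N1(2)[OF xN(1) r] by blast
    obtain d2 where d2: "d2 > 0" "\<And>h. 0 < h \<Longrightarrow> h < d2 \<Longrightarrow> \<bar>integral {-x..-x + h} (\<lambda>x. k (- x)) / h - k x\<bar> < r"
      using N2(2)[OF xN(2) r] by auto
    have kx: "k x = h x" using x by (simp add: k_def)
    have ik: "integral {u..v} h = integral {u..v} k" if "a \<le> u" "v \<le> b" for u v
      by (rule integral_cong) (use that in \<open>auto simp: k_def\<close>)
    define s where "s = min (min d1 d2) (min (x - a) (b - x))"
    have "s > 0" using d1 d2 x by (simp add: s_def)
    moreover have "\<bar>(integral {a..x + e} h - integral {a..x} h) / e - h x\<bar> < r" if e: "e \<noteq> 0" "\<bar>e\<bar> < s" for e
    proof (cases "e > 0")
      case True
      have "integral {a..x} k + integral {x..x+e} k = integral {a..x+e} k"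
        by (rule Henstock_Kurzweil_Integration.integral_combine) (use True x k in auto)
      then have "integral {a..x + e} h - integral {a..x} h = integral {x..x+e} k"
        using ik[of a x] ik[of a "x+e"] e x by (auto simp: s_def)
      then show ?thesis using d1(2)[of e] True e kx by (auto simp: s_def)
    next
      case False
      then have e0: "e < 0" using e by simp
      have "integral {a..x+e} k + integral {x+e..x} k = integral {a..x} k"
        by (rule Henstock_Kurzweil_Integration.integral_combine) (use e0 e x k in \<open>auto simp: s_def\<close>)
      then have "integral {a..x} h - integral {a..x+e} h = integral {x+e..x} k"
        using ik[of a x] ik[of a "x+e"] e x e0 by (auto simp: s_def)
      moreover have "integral {-x..-x + (-e)} (\<lambda>x. k (- x)) = integral {x+e..x} k"
        using Henstock_Kurzweil_Integration.integral_reflect_real[of "x" "x+e" k] by simp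
      ultimately have "(integral {a..x + e} h - integral {a..x} h) / e = integral {-x..-x + (-e)} (\<lambda>x. k (- x)) / (- e)"
        using e0 by (simp add: field_simps)
      then show ?thesis using d2(2)[of "-e"] e0 e kx by (auto simp: s_def)
    qed
    ultimately show "\<exists>s>0. \<forall>e. e \<noteq> 0 \<and> norm (e - 0) < s \<longrightarrow>
        norm ((integral {a..x + e} h - integral {a..x} h) / e - h x) < r"
      by (intro exI[of _ s]) auto
  qed
  then show ?thesis using N that by blast
qed

lemma lipschitz_on_deriv_le:
  fixes \<phi> :: "real \<Rightarrow> real"
  assumes lip: "L-lipschitz_on {a..b} \<phi>" and t: "t \<in> {a..b}" and "a < b"
    and der: "(\<phi> has_real_derivative d) (at t within {a..b})"
  shows "\<bar>d\<bar> \<le> L"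
proof -
  have "((\<lambda>y. (\<phi> y - \<phi> t) / (y - t)) \<longlongrightarrow> d) (at t within {a..b})"
    using der by (simp add: has_field_derivative_iff)
  then have "((\<lambda>y. \<bar>(\<phi> y - \<phi> t) / (y - t)\<bar>) \<longlongrightarrow> \<bar>d\<bar>) (at t within {a..b})" by (rule tendsto_rabs)
  moreover have "\<forall>\<^sub>F y in at t within {a..b}. \<bar>(\<phi> y - \<phi> t) / (y - t)\<bar> \<le> L"
    unfolding eventually_at_filter
    by (rule always_eventually) (use lipschitz_onD[OF lip, of _ t] t in \<open>auto simp: dist_real_def field_simps\<close>)
  moreover have "at t within {a..b} \<noteq> bot"
    using t \<open>a < b\<close> by (simp add: trivial_limit_within islimpt_Icc)
  ultimately show ?thesis by (rule tendsto_upperbound)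
qed

lemma lipschitz_on_indefinite_integral:
  fixes h :: "real \<Rightarrow> real"
  assumes h: "h integrable_on {a..b}" and N: "negligible N" 
    and B: "\<And>x. x \<in> {a..b} - N \<Longrightarrow> \<bar>h x\<bar> \<le> B" and "0 \<le> B"
  shows "B-lipschitz_on {a..b} (\<lambda>x. integral {a..x} h)"
proof (rule lipschitz_on_leI)
  fix x y assume xy: "x \<in> {a..b}" "y \<in> {a..b}" "x \<le> y"
  have "integral {a..x} h + integral {x..y} h = integral {a..y} h"
    by (rule Henstock_Kurzweil_Integration.integral_combine)
       (use xy in \<open>auto intro: integrable_on_subinterval[OF h]\<close>)
  moreover have "\<bar>integral {x..y} h\<bar> \<le> B * (y - x)"
  proof -
    \<comment> \<open>Setting \<open>h\<close> to 0 on \<open>N\<close> keeps the integral and turns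
      the bound into one at every point.\<close>
    have "((\<lambda>t. if t \<in> N then 0 else h t) has_integral integral {x..y} h) {x..y}"
      by (rule has_integral_spike[OF N _ integrable_integral])
         (use xy in \<open>auto intro: integrable_on_subinterval[OF h]\<close>)
    then show ?thesis
      using has_integral_bound_real[of B "{}" "\<lambda>t. if t \<in> N then 0 else h t" "integral {x..y} h" x y] xy B \<open>0 \<le> B\<close>
      by auto
  qed
  ultimately show "dist (integral {a..x} h) (integral {a..y} h) \<le> B * dist x y"
    using xy by (simp add: dist_real_def)
qed (use assms in auto)

text \<open>Off a null set the derivative is a limit of difference quotients bounded by
  \<open>L\<close>, hence integrable by dominated convergence. Then \<open>\<phi>\<close> minus the
  integral of \<open>\<phi>'\<close> is Lipschitz with derivative 0 almost everywhere, hence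
  constant.\<close>

lemma lipschitz_AE_FTC:
  fixes \<phi> \<phi>' :: "real \<Rightarrow> real"
  assumes lip: "L-lipschitz_on {a..b} \<phi>" and N: "negligible N"
    and der: "\<And>t. t \<in> {a<..<b} - N \<Longrightarrow> (\<phi> has_real_derivative \<phi>' t) (at t)"
  shows "\<phi>' integrable_on {a..b}"
    and "\<And>x. x \<in> {a..b} \<Longrightarrow> integral {a..x} \<phi>' = \<phi> x - \<phi> a"
proof -
  have L0: "0 \<le> L" using lip by (rule lipschitz_on_nonneg)
  \<comment> \<open>Extending \<open>\<phi>\<close> constantly beyond \<open>{a..b}\<close> makes
    the forward quotients continuous functions on the whole interval without enlarging the Lipschitz
    constant.\<close>
  define \<psi> where "\<psi> x = \<phi> (max a (min b x))" for x
  have bound: "\<bar>\<phi>' t\<bar> \<le> L" if t: "t \<in> {a<..<b} - N" for t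
    by (rule lipschitz_on_deriv_le[OF lip _ _ has_field_derivative_at_within[OF der[OF t]]]) (use t in auto)
  have int: "\<phi>' integrable_on {a..b}"
  proof (cases "a < b")
    case True
    have cont: "continuous_on UNIV \<psi>"
      unfolding \<psi>_def
      by (rule continuous_on_compose2[OF lipschitz_on_continuous_on[OF lip]])
         (use True in \<open>auto intro!: continuous_intros\<close>)
    define S where "S = {a<..<b} - N"
    define q where "q n x = (\<psi> (x + inverse (real (Suc n))) - \<psi> x) / inverse (real (Suc n))" for n x
    have qi: "q n integrable_on {a..b}" for n
      unfolding q_def
      by (intro integrable_continuous_real continuous_intros continuous_on_compose2[OF cont]) auto
    define N' where "N' = N \<union> {a, b}"
    have N': "negligible N'" using N by (simp add: N'_def)
    have qi': "(\<lambda>x. if x \<in> S then q n x else 0) integrable_on {a..b}" for n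
      by (rule integrable_spike[OF qi N']) (auto simp: S_def N'_def)
    have qL: "\<bar>q n x\<bar> \<le> L" for n x
    proof -
      have "\<bar>\<psi> (x + inverse (real (Suc n))) - \<psi> x\<bar> \<le> L * \<bar>max a (min b (x + inverse (real (Suc n)))) - max a (min b x)\<bar>"
        unfolding \<psi>_def using lipschitz_onD[OF lip, of "max a (min b (x + inverse (real (Suc n))))" "max a (min b x)"] True
        by (simp add: dist_real_def)
      also have "\<dots> \<le> L * inverse (real (Suc n))"
      proof (rule mult_left_mono[OF _ L0])
        have "inverse (real (Suc n)) > 0" by simp
        then show "\<bar>max a (min b (x + inverse (real (Suc n)))) - max a (min b x)\<bar> \<le> inverse (real (Suc n))"
          by linarith
      qed
      finally show ?thesis
        unfolding q_def abs_divide by (subst pos_divide_le_eq) (auto simp del: of_nat_Suc)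
    qed
    have lim: "(\<lambda>n. if x \<in> S then q n x else 0) \<longlonglongrightarrow> (if x \<in> S then \<phi>' x else 0)" for x
    proof (cases "x \<in> S")
      case True
      then have x: "x \<in> {a<..<b} - N" by (simp add: S_def)
      have "\<forall>\<^sub>F y in nhds x. \<psi> y = \<phi> y"
      proof -
        have "\<forall>\<^sub>F y in nhds x. y \<in> {a<..<b}" using x by (intro eventually_nhds_in_open) auto
        then show ?thesis by eventually_elim (auto simp: \<psi>_def)
      qed
      then have "(\<psi> has_real_derivative \<phi>' x) (at x)"
        using der[OF x] DERIV_cong_ev[of x x \<psi> \<phi> "\<phi>' x" "\<phi>' x"] by simp
      then have "((\<lambda>h. (\<psi> (x + h) - \<psi> x) / h) \<longlongrightarrow> \<phi>' x) (at 0)" by (simp add: DERIV_def)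
      moreover have "filterlim (\<lambda>n. inverse (real (Suc n))) (at 0) sequentially"
        using LIMSEQ_inverse_real_of_nat by (auto simp: filterlim_at)
      ultimately have "(\<lambda>n. q n x) \<longlonglongrightarrow> \<phi>' x" unfolding q_def by (rule filterlim_compose)
      then show ?thesis using True by simp
    qed auto
    have "(\<lambda>x. if x \<in> S then \<phi>' x else 0) integrable_on {a..b}"
      by (rule dominated_convergence(1)[where f = "\<lambda>n x. if x \<in> S then q n x else 0" and h = "\<lambda>_. L"])
         (use qi' qL L0 lim in auto)
    then show ?thesis
      by (rule integrable_spike[OF _ N']) (auto simp: S_def N'_def)
  next
    case False
    then have "measure lborel (cbox a b) = 0" by simp
    then show ?thesis using integrable_on_null[of a b \<phi>'] by simp
  qed
  then show "\<phi>' integrable_on {a..b}" .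
  fix x assume x: "x \<in> {a..b}"
  obtain M where M: "negligible M"
    "\<And>x. x \<in> {a<..<b} - M \<Longrightarrow> ((\<lambda>x. integral {a..x} \<phi>') has_real_derivative \<phi>' x) (at x)"
    using indefinite_integral_deriv_AE[OF int] by blast
  have l2: "L-lipschitz_on {a..b} (\<lambda>x. integral {a..x} \<phi>')"
    by (rule lipschitz_on_indefinite_integral[OF int, of "N \<union> {a, b}"]) (use N bound L0 in auto)
  have "\<phi> x - integral {a..x} \<phi>' = \<phi> a - integral {a..a} \<phi>'"
  proof (rule lipschitz_AE_deriv_zero[OF lipschitz_on_diff[OF lip l2] _ _ x])
    show "negligible (N \<union> M)" using N M by simp
    fix t assume "t \<in> {a<..<b} - (N \<union> M)"
    then show "((\<lambda>x. \<phi> x - integral {a..x} \<phi>') has_real_derivative 0) (at t)"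
      using DERIV_diff[OF der[of t] M(2)[of t]] by simp
  qed
  then show "integral {a..x} \<phi>' = \<phi> x - \<phi> a" by simp
qed

lemma lipschitz_on_uminus: "1-lipschitz_on S (\<lambda>x::real. - x)"
  by (rule lipschitz_onI) (auto simp: dist_real_def)

section \<open>Exceptional null sets, monotone fronts and essentially bounded data\<close>

lemma AE_lebesgue_on_iff_negligible:
  "(AE t\<in>S in lebesgue. P t) \<longleftrightarrow> (\<exists>N. negligible N \<and> (\<forall>t\<in>S - N. P t))" for S :: "'a::euclidean_space set"
proof
  assume "AE t\<in>S in lebesgue. P t"
  then obtain N where "N \<in> null_sets lebesgue" "{t \<in> space lebesgue. \<not> (t \<in> S \<longrightarrow> P t)} \<subseteq> N"
    unfolding eventually_ae_filter by auto
  then show "\<exists>N. negligible N \<and> (\<forall>t\<in>S - N. P t)" by (intro exI[of _ N]) (auto simp: negligible_iff_null_sets)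
next
  assume "\<exists>N. negligible N \<and> (\<forall>t\<in>S - N. P t)"
  then show "AE t\<in>S in lebesgue. P t"
    unfolding eventually_ae_filter by (auto simp: negligible_iff_null_sets)
qed

lemma C01_on_AE_deriv_ge:
  fixes \<phi> :: "real \<Rightarrow> real"
  assumes "C01_on {a..b} \<phi>" "negligible N"
    "\<And>t. t \<in> {a<..<b} - N \<Longrightarrow> \<exists>d\<ge>c. (\<phi> has_real_derivative d) (at t)" "a \<le> x" "x \<le> y" "y \<le> b"
  shows "c * (y - x) \<le> \<phi> y - \<phi> x"
  using assms lipschitz_AE_deriv_ge unfolding C01_on_def by metis

text \<open>A bound below 1 that may depend on the time is enough for monotonicity. It is what is
  known about a front before \<open>t - l t\<close> has been located in the domain of
  \<open>f\<close>, and all that is known on the initial branch.\<close>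

lemma C01_on_slope_less_1_mono:
  assumes "C01_on {0..T} l" "negligible N"
    and der: "\<And>t. t \<in> {0<..<T} - N \<Longrightarrow> \<exists>p. 0 \<le> p \<and> p < 1 \<and> (l has_real_derivative p) (at t)"
    and st: "0 \<le> s" "s \<le> t" "t \<le> T"
  shows "l s \<le> l t" "s - l s \<le> t - l t"
proof -
  have "0 * (t - s) \<le> l t - l s"
    by (rule C01_on_AE_deriv_ge[OF assms(1,2) _ st]) (use der in blast)
  then show "l s \<le> l t" by simp
  obtain L where L: "L-lipschitz_on {0..T} l" using assms(1) by (auto simp: C01_on_def)
  have "0 * (t - s) \<le> (t - l t) - (s - l s)"
  proof (rule C01_on_AE_deriv_ge[OF _ assms(2) _ st])
    show "C01_on {0..T} (\<lambda>t. t - l t)"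
      unfolding C01_on_def by (rule exI, rule lipschitz_on_diff[OF lipschitz_on_id L])
    fix t assume "t \<in> {0<..<T} - N"
    then obtain p where "0 \<le> p" "p < 1" "(l has_real_derivative p) (at t)" using der by blast
    then show "\<exists>d\<ge>0. ((\<lambda>t. t - l t) has_real_derivative d) (at t)"
      by (intro exI[of _ "1 - p"]) (auto intro!: derivative_eq_intros)
  qed
  then show "s - l s \<le> t - l t" by simp
qed

lemma C1_on_has_real_derivative:
  assumes "C1_on a b f" "x \<in> {a..b}"
  shows "(f has_real_derivative D_on a b f x) (at x within {a..b})"
  using assms unfolding C1_on_def D_on_def
  by (auto simp: has_real_derivative_iff_has_vector_derivative vector_derivative_works)

lemma Linf_norm_AE:
  "AE x\<in>{a..b} in lebesgue. ereal \<bar>f x\<bar> \<le> Linf_norm a b f"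
proof -
  have "AE x in lebesgue_on {a..b}. ereal \<bar>f x\<bar> \<le> Linf_norm a b f"
    unfolding Linf_norm_def by (rule esssup_AE)
  then show ?thesis by (subst (asm) AE_restrict_space_iff) auto
qed

lemma Linf_on_bounded_AE:
  assumes "Linf_on a b f"
  obtains B N where "0 \<le> B" "negligible N" "\<And>x. x \<in> {a..b} - N \<Longrightarrow> \<bar>f x\<bar> \<le> B"
proof -
  obtain N where N: "negligible N" "\<And>x. x \<in> {a..b} - N \<Longrightarrow> ereal \<bar>f x\<bar> \<le> Linf_norm a b f"
    using Linf_norm_AE[of a b f] unfolding AE_lebesgue_on_iff_negligible by blast
  have "Linf_norm a b f < \<infinity>" using assms by (simp add: Linf_on_def)
  then obtain B where B: "Linf_norm a b f \<le> ereal B" by (cases "Linf_norm a b f") auto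
  have "\<bar>f x\<bar> \<le> max B 0" if "x \<in> {a..b} - N" for x
    using order_trans[OF N(2)[OF that] B] by simp
  then show ?thesis using that[of "max B 0" N] N by simp
qed

lemma Linf_on_integrable:
  assumes "Linf_on a b f"
  shows "f integrable_on {a..b}"
proof -
  obtain B N where BN: "0 \<le> B" "negligible N" "\<And>x. x \<in> {a..b} - N \<Longrightarrow> \<bar>f x\<bar> \<le> B"
    using Linf_on_bounded_AE[OF assms] by blast
  \<comment> \<open>Clipping at level \<open>B\<close> changes \<open>f\<close> only on the null set
    \<open>N\<close>.\<close>
  have "(\<lambda>x. max (-B) (min B (f x))) integrable_on {a..b}"
  proof (rule measurable_bounded_by_integrable_imp_integrable_real)
    show "(\<lambda>x. max (-B) (min B (f x))) \<in> borel_measurable (lebesgue_on {a..b})"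
      using assms unfolding Linf_on_def by (intro borel_measurable_max borel_measurable_min) auto
    show "(\<lambda>_. B) integrable_on {a..b}" by (simp add: integrable_const_ivl)
  qed (use BN in auto)
  then show ?thesis
    by (rule integrable_spike[OF _ BN(2)]) (use BN(3) in \<open>force simp: min_def max_def\<close>)
qed

section \<open>The front equation\<close>

text \<open>Griffith's criterion solved for the speed, \<open>d\<close> being the derivative of the
  wave that arrives at the front and \<open>k\<close> the toughness there. For \<open>k > 0\<close>
  the front moves exactly if \<open>2 * d\<^sup>2 > k\<close>.\<close>

definition front_speed :: "real \<Rightarrow> real \<Rightarrow> real" where
  "front_speed d k = max ((2 * d\<^sup>2 - k) / (2 * d\<^sup>2 + k)) 0"

lemma front_speed_bounds:
  assumes "0 < k"
  shows "0 \<le> front_speed d k" "front_speed d k < 1"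
  using assms by (auto simp: front_speed_def add_pos_nonneg divide_less_eq add_nonneg_pos)

text \<open>Where the front moves, the gap is \<open>2 * k / (2 * d\<^sup>2 + k)\<close>, smallest
  for \<open>k = c\<close> and \<open>\<bar>d\<bar> = B\<close>. Half of that value is kept, so that
  the bound is also at most 1, the gap of a front at rest.\<close>

lemma one_minus_front_speed_ge:
  assumes "\<bar>d\<bar> \<le> B" "0 < c" "c \<le> k"
  shows "c / (2 * B\<^sup>2 + c) \<le> 1 - front_speed d k"
proof -
  have k: "0 < k" using assms by simp
  have dB: "d\<^sup>2 \<le> B\<^sup>2" using assms(1) by (metis abs_le_square_iff abs_ge_zero order_trans abs_of_nonneg)
  have "c * d\<^sup>2 \<le> k * B\<^sup>2" using dB assms by (intro mult_mono) auto
  have "c * (2 * d\<^sup>2 + k) = 2 * (c * d\<^sup>2) + c * k" by algebra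
  also have "\<dots> \<le> 4 * (k * B\<^sup>2) + 2 * (c * k)"
  proof (rule add_mono)
    have aux: "x \<le> y \<Longrightarrow> 0 \<le> y \<Longrightarrow> 2 * x \<le> 4 * y" for x y :: real by linarith
    show "2 * (c * d\<^sup>2) \<le> 4 * (k * B\<^sup>2)"
      by (rule aux[OF \<open>c * d\<^sup>2 \<le> k * B\<^sup>2\<close>]) (use k in simp)
    show "c * k \<le> 2 * (c * k)" using k assms by simp
  qed
  also have "\<dots> = 2 * k * (2 * B\<^sup>2 + c)" by algebra
  finally have "c * (2 * d\<^sup>2 + k) \<le> 2 * k * (2 * B\<^sup>2 + c)" .
  moreover have "0 < 2 * d\<^sup>2 + k" "0 < 2 * B\<^sup>2 + c" using k assms by (simp_all add: add_nonneg_pos)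
  ultimately have "c / (2 * B\<^sup>2 + c) \<le> 2 * k / (2 * d\<^sup>2 + k)" by (simp add: frac_le_eq divide_simps)
  also have "\<dots> = 1 - (2 * d\<^sup>2 - k) / (2 * d\<^sup>2 + k)" using \<open>0 < 2 * d\<^sup>2 + k\<close> by (simp add: field_simps)
  finally have "c / (2 * B\<^sup>2 + c) \<le> 1 - (2 * d\<^sup>2 - k) / (2 * d\<^sup>2 + k)" .
  moreover have "c / (2 * B\<^sup>2 + c) \<le> 1" using \<open>0 < 2 * B\<^sup>2 + c\<close> by simp
  ultimately show ?thesis by (simp add: front_speed_def max_def)
qed

text \<open>If \<open>s = t - l t\<close>, then \<open>dt/ds\<close> is the inverse of
  \<open>1 - l'\<close>, and the length \<open>t - s\<close>, as a function of \<open>s\<close>, has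
  derivative one less. This turns the front equation into its form along characteristics.\<close>

lemma inverse_one_minus_front_speed:
  assumes "0 < k"
  shows "inverse (1 - front_speed d k) - 1 = max (d\<^sup>2 / k - 1/2) 0"
proof (cases "2 * d\<^sup>2 \<le> k")
  case True
  then have "(2 * d\<^sup>2 - k) / (2 * d\<^sup>2 + k) \<le> 0" using assms by (simp add: divide_nonpos_pos add_nonneg_pos)
  moreover have "d\<^sup>2 / k - 1/2 \<le> 0" using True assms by (simp add: field_simps)
  ultimately show ?thesis by (simp add: front_speed_def)
next
  case False
  have p: "0 < 2 * d\<^sup>2 + k" using assms by (simp add: add_nonneg_pos)
  have "front_speed d k = (2 * d\<^sup>2 - k) / (2 * d\<^sup>2 + k)" using False p by (simp add: front_speed_def)
  then have "1 - front_speed d k = 2 * k / (2 * d\<^sup>2 + k)" using p by (simp add: field_simps)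
  then have "inverse (1 - front_speed d k) = (2 * d\<^sup>2 + k) / (2 * k)" by simp
  then have "inverse (1 - front_speed d k) - 1 = d\<^sup>2 / k - 1/2" using assms by (simp add: field_simps)
  moreover have "d\<^sup>2 / k - 1/2 \<ge> 0" using False assms by (simp add: field_simps)
  ultimately show ?thesis by simp
qed

locale toughness =
  fixes \<kappa> :: "real \<Rightarrow> real" and c1 :: real
  assumes c1_pos: "0 < c1"
    and lower: "\<And>x. 0 \<le> x \<Longrightarrow> c1 \<le> \<kappa> x"
    and lip: "local_lipschitz (UNIV :: real set) {0..} (\<lambda>_. \<kappa>)"
begin

lemma pos: "0 \<le> x \<Longrightarrow> 0 < \<kappa> x"
  using lower[of x] c1_pos by linarith

lemma lipschitz_on_Icc: "\<exists>L. L-lipschitz_on {0..R} \<kappa>"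
proof -
  have "local_lipschitz {0::real} {0..R} (\<lambda>_. \<kappa>)" by (rule local_lipschitz_subset[OF lip]) auto
  then obtain L where "\<And>t. t \<in> {0::real} \<Longrightarrow> L-lipschitz_on {0..R} \<kappa>"
    using local_lipschitz_compact_implies_lipschitz[of "{0::real}" "{0..R}" "\<lambda>_. \<kappa>"] by auto
  then show ?thesis by blast
qed

text \<open>The part of \<open>C01_solution\<close> that couples \<open>f\<close> and
  \<open>l\<close> only. Data and control enter a solution through formulas for \<open>f\<close>;
  leaving \<open>f\<close> an arbitrary Lipschitz function allows it to be prescribed, as the
  steering does.\<close>

definition front :: "real \<Rightarrow> real \<Rightarrow> (real \<Rightarrow> real) \<Rightarrow> (real \<Rightarrow> real) \<Rightarrow> bool" where
  "front l0 T f l \<longleftrightarrow> l 0 = l0 \<and> (\<forall>t\<in>{0..T}. 0 < l t) \<and> C01_on {0..T} l \<and> C01_on {-l0..T} f \<and>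
     (AE t\<in>{0..T} in lebesgue. \<exists>d.
        (f has_real_derivative d) (at (t - l t) within {-l0..T}) \<and>
        (l has_real_derivative front_speed d (\<kappa> (l t))) (at t within {0..T}))"

lemma front_pos: "front l0 T f l \<Longrightarrow> t \<in> {0..T} \<Longrightarrow> 0 < l t"
  by (simp add: front_def)

text \<open>A bootstrap: monotonicity keeps \<open>t - l t\<close> in the domain of
  \<open>f\<close>, the Lipschitz constant \<open>B\<close> of \<open>f\<close> then bounds its
  derivative, and this bounds the speed away from 1. Strict increase of \<open>t - l t\<close>
  finally moves it into the interior of the domain for \<open>0 < t < T\<close>, where derivatives
  are two-sided.\<close>

lemma front_ode:
  assumes f: "front l0 T f l" and "0 < T" "0 < l0"
  obtains c B N where "0 < c" "negligible N"
    "\<And>s t. 0 \<le> s \<Longrightarrow> s \<le> t \<Longrightarrow> t \<le> T \<Longrightarrow> l s \<le> l t"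
    "\<And>s t. 0 \<le> s \<Longrightarrow> s \<le> t \<Longrightarrow> t \<le> T \<Longrightarrow> c * (t - s) \<le> (t - l t) - (s - l s)"
    "\<And>t. t \<in> {0<..<T} - N \<Longrightarrow> \<exists>d. \<bar>d\<bar> \<le> B \<and> (f has_real_derivative d) (at (t - l t)) \<and>
        (l has_real_derivative front_speed d (\<kappa> (l t))) (at t)"
proof -
  have pos_l: "0 < l t" if "t \<in> {0..T}" for t using f that by (simp add: front_def)
  have l0: "l 0 = l0" using f by (simp add: front_def)
  obtain N where N: "negligible N" and ode: "\<And>t. t \<in> {0..T} - N \<Longrightarrow> \<exists>d.
        (f has_real_derivative d) (at (t - l t) within {-l0..T}) \<and>
        (l has_real_derivative front_speed d (\<kappa> (l t))) (at t within {0..T})"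
  proof -
    have "AE t\<in>{0..T} in lebesgue. \<exists>d. (f has_real_derivative d) (at (t - l t) within {-l0..T}) \<and>
        (l has_real_derivative front_speed d (\<kappa> (l t))) (at t within {0..T})"
      using f by (simp add: front_def)
    then show ?thesis using that unfolding AE_lebesgue_on_iff_negligible by blast
  qed
  obtain L where L: "L-lipschitz_on {0..T} l" using f by (auto simp: front_def C01_on_def)
  obtain B where B: "B-lipschitz_on {-l0..T} f" using f by (auto simp: front_def C01_on_def)
  have lC: "C01_on {0..T} l" using f by (simp add: front_def)
  have at: "at t within {0..T} = at t" if "t \<in> {0<..<T}" for t using that by (simp add: at_within_Icc_at)
  have w: "\<exists>p. 0 \<le> p \<and> p < 1 \<and> (l has_real_derivative p) (at t)" if "t \<in> {0<..<T} - N" for t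
  proof -
    have "t \<in> {0..T} - N" using that by auto
    then obtain d where "(l has_real_derivative front_speed d (\<kappa> (l t))) (at t within {0..T})" using ode by blast
    moreover have "0 < \<kappa> (l t)" using pos_l[of t] that by (intro pos) auto
    ultimately show ?thesis using front_speed_bounds at[of t] that by (metis DiffD1)
  qed
  note mono = C01_on_slope_less_1_mono[OF lC N w]
  have th: "t - l t \<in> {-l0..T}" if "t \<in> {0..T}" for t
    using mono(2)[of 0 t] that l0 pos_l[of t] by auto
  define c where "c = c1 / (2 * B\<^sup>2 + c1)"
  have "c > 0" using c1_pos by (simp add: c_def add_nonneg_pos)
  have ode2: "\<exists>d. \<bar>d\<bar> \<le> B \<and> (f has_real_derivative d) (at (t - l t) within {-l0..T}) \<and>
        (l has_real_derivative front_speed d (\<kappa> (l t))) (at t)" if t: "t \<in> {0<..<T} - N" for t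
  proof -
    have "t \<in> {0..T} - N" using t by auto
    then obtain d where d: "(f has_real_derivative d) (at (t - l t) within {-l0..T})"
        "(l has_real_derivative front_speed d (\<kappa> (l t))) (at t within {0..T})" using ode by blast
    moreover have "\<bar>d\<bar> \<le> B"
      by (rule lipschitz_on_deriv_le[OF B _ _ d(1)]) (use th[of t] t assms in auto)
    ultimately show ?thesis using at[of t] t by auto
  qed
  have slope: "c * (t - s) \<le> (t - l t) - (s - l s)" if st: "0 \<le> s" "s \<le> t" "t \<le> T" for s t
  proof (rule C01_on_AE_deriv_ge[OF _ N _ st])
    show "C01_on {0..T} (\<lambda>t. t - l t)"
      unfolding C01_on_def by (rule exI, rule lipschitz_on_diff[OF lipschitz_on_id L])
    fix t assume t: "t \<in> {0<..<T} - N"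
    then obtain d where d: "\<bar>d\<bar> \<le> B" "(l has_real_derivative front_speed d (\<kappa> (l t))) (at t)"
      using ode2 by blast
    have "0 \<le> l t" using pos_l[of t] t by auto
    then have "c \<le> 1 - front_speed d (\<kappa> (l t))"
      unfolding c_def by (intro one_minus_front_speed_ge d c1_pos lower)
    then show "\<exists>d\<ge>c. ((\<lambda>t. t - l t) has_real_derivative d) (at t)"
      using d by (intro exI[of _ "1 - front_speed d (\<kappa> (l t))"]) (auto intro!: derivative_eq_intros)
  qed
  show ?thesis
  proof (rule that[OF \<open>c > 0\<close> N _ slope])
    fix t assume t: "t \<in> {0<..<T} - N"
    have "0 < c * t" using \<open>c > 0\<close> t by simp
    then have "-l0 < t - l t" using slope[of 0 t] t l0 by auto
    moreover have "t - l t < T" using pos_l[of t] t by auto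
    ultimately have "at (t - l t) within {-l0..T} = at (t - l t)" by (simp add: at_within_Icc_at)
    then show "\<exists>d. \<bar>d\<bar> \<le> B \<and> (f has_real_derivative d) (at (t - l t)) \<and>
        (l has_real_derivative front_speed d (\<kappa> (l t))) (at t)" using ode2[OF t] by simp
  qed (use mono in auto)
qed

text \<open>Along the characteristics \<open>s = t - l t\<close> the front equation has a right-hand side that is
  Lipschitz in the unknown, unlike in the variable \<open>t\<close>.\<close>
lemma front_reparametrized:
  assumes f: "front l0 T f l" and "0 < T" "0 < l0"
  obtains \<Lambda> B N where "C01_on {-l0..T - l T} \<Lambda>" "\<Lambda> (-l0) = l0"
    "\<And>t. t \<in> {0..T} \<Longrightarrow> t - l t \<in> {-l0..T - l T} \<and> \<Lambda> (t - l t) = l t"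
    "\<And>s. s \<in> {-l0..T - l T} \<Longrightarrow> s + \<Lambda> s \<in> {0..T} \<and> l (s + \<Lambda> s) = \<Lambda> s \<and> \<Lambda> s \<in> {0..l T}"
    "negligible N"
    "\<And>s. s \<in> {-l0<..<T - l T} - N \<Longrightarrow> \<exists>d. \<bar>d\<bar> \<le> B \<and> (f has_real_derivative d) (at s) \<and>
        (\<Lambda> has_real_derivative max (d\<^sup>2 / \<kappa> (\<Lambda> s) - 1/2) 0) (at s)"
proof -
  obtain c B N where c: "0 < c" and N: "negligible N"
    and mono: "\<And>s t. 0 \<le> s \<Longrightarrow> s \<le> t \<Longrightarrow> t \<le> T \<Longrightarrow> l s \<le> l t"
    and slope: "\<And>s t. 0 \<le> s \<Longrightarrow> s \<le> t \<Longrightarrow> t \<le> T \<Longrightarrow> c * (t - s) \<le> (t - l t) - (s - l s)"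
    and ode: "\<And>t. t \<in> {0<..<T} - N \<Longrightarrow> \<exists>d. \<bar>d\<bar> \<le> B \<and> (f has_real_derivative d) (at (t - l t)) \<and>
        (l has_real_derivative front_speed d (\<kappa> (l t))) (at t)"
    by (rule front_ode[OF assms], rule that)
  have l0: "l 0 = l0" using f by (simp add: front_def)
  obtain L where L: "L-lipschitz_on {0..T} l" using f by (auto simp: front_def C01_on_def)
  define \<theta> where "\<theta> t = t - l t" for t
  have \<theta>L: "(1 + L)-lipschitz_on {0..T} \<theta>"
    unfolding \<theta>_def by (intro lipschitz_on_diff lipschitz_on_id L)
  have slope': "c * \<bar>t - s\<bar> \<le> \<bar>\<theta> t - \<theta> s\<bar>" if "s \<in> {0..T}" "t \<in> {0..T}" for s t
    using slope[of s t] slope[of t s] that unfolding \<theta>_def by (cases "s \<le> t") auto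
  have \<theta>m: "\<theta> s < \<theta> t" if "0 \<le> s" "s < t" "t \<le> T" for s t
  proof -
    have "0 < c * (t - s)" using that c by simp
    also have "\<dots> \<le> (t - l t) - (s - l s)" using that by (intro slope) auto
    finally show ?thesis by (simp add: \<theta>_def)
  qed
  have inj: "inj_on \<theta> {0..T}"
    by (rule inj_onI) (use \<theta>m in \<open>metis atLeastAtMost_iff linorder_neqE_linordered_idom less_irrefl\<close>)
  have ends: "\<theta> 0 = - l0" "\<theta> T = T - l T" using l0 by (simp_all add: \<theta>_def)
  have range: "\<theta> ` {0..T} = {-l0..T - l T}"
  proof
    show "\<theta> ` {0..T} \<subseteq> {-l0..T - l T}"
    proof clarify
      fix t assume t: "t \<in> {0..T}"
      then have "\<theta> 0 \<le> \<theta> t" "\<theta> t \<le> \<theta> T"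
        using \<theta>m[of 0 t] \<theta>m[of t T] by (cases "t = 0", auto, cases "t = T", auto)
      then show "\<theta> t \<in> {-l0..T - l T}" using ends by simp
    qed
    show "{-l0..T - l T} \<subseteq> \<theta> ` {0..T}"
    proof
      fix s assume "s \<in> {-l0..T - l T}"
      then have "\<exists>t\<ge>0. t \<le> T \<and> \<theta> t = s"
        using ends \<open>0 < T\<close> lipschitz_on_continuous_on[OF \<theta>L] by (intro IVT') auto
      then show "s \<in> \<theta> ` {0..T}" by auto
    qed
  qed
  define \<psi> where "\<psi> = the_inv_into {0..T} \<theta>"
  have \<psi>\<theta>: "\<psi> (\<theta> t) = t" if "t \<in> {0..T}" for t
    unfolding \<psi>_def using inj that by (rule the_inv_into_f_f)
  have \<theta>\<psi>: "\<theta> (\<psi> s) = s" if "s \<in> {-l0..T - l T}" for s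
    unfolding \<psi>_def using inj that range by (simp add: f_the_inv_into_f)
  have \<psi>: "\<psi> s \<in> {0..T}" if "s \<in> {-l0..T - l T}" for s
    using that range \<psi>\<theta> by (metis imageE)
  \<comment> \<open>The characteristic \<open>s\<close> meets the front at time
    \<open>\<psi> s\<close>, and the length at that time is \<open>\<psi> s - s\<close>.\<close>
  define \<Lambda> where "\<Lambda> s = \<psi> s - s" for s
  have \<psi>L: "(inverse c)-lipschitz_on {-l0..T - l T} \<psi>"
  proof (rule lipschitz_onI)
    fix x y assume xy: "x \<in> {-l0..T - l T}" "y \<in> {-l0..T - l T}"
    have "c * \<bar>\<psi> x - \<psi> y\<bar> \<le> \<bar>x - y\<bar>" using slope'[OF \<psi>[OF xy(2)] \<psi>[OF xy(1)]] \<theta>\<psi> xy by simp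
    then show "dist (\<psi> x) (\<psi> y) \<le> inverse c * dist x y" using c by (simp add: dist_real_def field_simps)
  qed (use c in simp)
  have \<Lambda>C: "C01_on {-l0..T - l T} \<Lambda>"
    unfolding C01_on_def \<Lambda>_def by (rule exI, rule lipschitz_on_diff[OF \<psi>L lipschitz_on_id])
  have \<Lambda>l: "l (\<psi> s) = \<Lambda> s" if "s \<in> {-l0..T - l T}" for s
    using \<theta>\<psi>[OF that] by (simp add: \<theta>_def \<Lambda>_def)
  \<comment> \<open>For \<open>s\<close> outside the image of the exceptional times, the meeting
    time \<open>\<psi> s\<close> is a good one; the image is null because \<open>\<theta>\<close> is
    Lipschitz.\<close>
  define N' where "N' = \<theta> ` (N \<inter> {0..T})"
  have N': "negligible N'"
    unfolding N'_def by (rule negligible_lipschitz_image[OF \<theta>L]) (use N in \<open>auto intro: negligible_subset\<close>)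
  show ?thesis
  proof (rule that[OF \<Lambda>C _ _ _ N'])
    show "\<Lambda> (-l0) = l0" using \<psi>\<theta>[of 0] ends \<open>0 < T\<close> by (simp add: \<Lambda>_def)
    show "t - l t \<in> {-l0..T - l T} \<and> \<Lambda> (t - l t) = l t" if "t \<in> {0..T}" for t
    proof
      show "t - l t \<in> {-l0..T - l T}" using range that unfolding \<theta>_def by blast
      show "\<Lambda> (t - l t) = l t" using \<psi>\<theta>[OF that] by (simp add: \<Lambda>_def \<theta>_def)
    qed
    show "s + \<Lambda> s \<in> {0..T} \<and> l (s + \<Lambda> s) = \<Lambda> s \<and> \<Lambda> s \<in> {0..l T}" if s: "s \<in> {-l0..T - l T}" for s
      using \<psi>[OF s] \<Lambda>l[OF s] front_pos[OF f \<psi>[OF s]] mono[of "\<psi> s" T] by (auto simp: \<Lambda>_def)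
    fix s assume s: "s \<in> {-l0<..<T - l T} - N'"
    then have s': "s \<in> {-l0..T - l T}" by auto
    define t where "t = \<psi> s"
    have t: "t \<in> {0..T}" "\<theta> t = s" using \<psi>[OF s'] \<theta>\<psi>[OF s'] by (auto simp: t_def)
    have "t \<notin> N" using s t unfolding N'_def by auto
    moreover have "t \<noteq> 0" "t \<noteq> T" using t s ends by auto
    ultimately have "t \<in> {0<..<T} - N" using t by auto
    then obtain d where d: "\<bar>d\<bar> \<le> B" "(f has_real_derivative d) (at (t - l t))"
        "(l has_real_derivative front_speed d (\<kappa> (l t))) (at t)" using ode by blast
    have lt: "l t = \<Lambda> s" using \<Lambda>l[OF s'] by (simp add: t_def)
    have k0: "0 < \<kappa> (l t)" using front_pos[OF f t(1)] by (intro pos) simp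
    have "(\<theta> has_real_derivative (1 - front_speed d (\<kappa> (l t)))) (at (\<psi> s))"
      unfolding \<theta>_def using d(3) by (auto intro!: derivative_eq_intros simp: t_def)
    then have "(\<psi> has_real_derivative inverse (1 - front_speed d (\<kappa> (l t)))) (at s)"
    proof (rule DERIV_inverse_function)
      show "1 - front_speed d (\<kappa> (l t)) \<noteq> 0" using front_speed_bounds[OF k0, of d] by simp
      show "-l0 < s" "s < T - l T" using s by auto
      show "\<theta> (\<psi> y) = y" if "-l0 < y" "y < T - l T" for y using \<theta>\<psi>[of y] that by auto
      show "isCont \<psi> s"
        using lipschitz_on_continuous_on[OF \<psi>L] s by (auto intro: continuous_on_interior)
    qed
    then have "(\<Lambda> has_real_derivative inverse (1 - front_speed d (\<kappa> (l t))) - 1) (at s)"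
      unfolding \<Lambda>_def by (intro derivative_intros)
    then have "(\<Lambda> has_real_derivative max (d\<^sup>2 / \<kappa> (\<Lambda> s) - 1/2) 0) (at s)"
      using inverse_one_minus_front_speed[OF k0, of d] lt by simp
    moreover have "(f has_real_derivative d) (at s)" using d(2) t(2) by (simp add: \<theta>_def)
    ultimately show "\<exists>d. \<bar>d\<bar> \<le> B \<and> (f has_real_derivative d) (at s) \<and>
        (\<Lambda> has_real_derivative max (d\<^sup>2 / \<kappa> (\<Lambda> s) - 1/2) 0) (at s)" using d(1) by blast
  qed
qed

text \<open>In the variable \<open>s\<close> both fronts solve the same equation up to
  \<open>a\<close>, and Gronwall's estimate applies where both are defined. The two domains end at
  \<open>T - l T\<close> and \<open>T - L T\<close>, which might differ, so their coincidence has to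
  be argued as well.\<close>

lemma front_unique:
  assumes f: "front l0 T f l" and F: "front l0 T F L" and "0 < T" "0 < l0"
    and eq: "\<And>s. s \<in> {-l0..T} \<Longrightarrow> s \<le> a \<Longrightarrow> f s = F s"
    and t: "t \<in> {0..T}" "t - l t \<le> a"
  shows "l t = L t"
proof -
  obtain \<Lambda> B N where \<Lambda>: "C01_on {-l0..T - l T} \<Lambda>" "\<Lambda> (-l0) = l0"
    "\<And>t. t \<in> {0..T} \<Longrightarrow> t - l t \<in> {-l0..T - l T} \<and> \<Lambda> (t - l t) = l t"
    "\<And>s. s \<in> {-l0..T - l T} \<Longrightarrow> s + \<Lambda> s \<in> {0..T} \<and> l (s + \<Lambda> s) = \<Lambda> s \<and> \<Lambda> s \<in> {0..l T}"
    "negligible N"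
    "\<And>s. s \<in> {-l0<..<T - l T} - N \<Longrightarrow> \<exists>d. \<bar>d\<bar> \<le> B \<and> (f has_real_derivative d) (at s) \<and>
        (\<Lambda> has_real_derivative max (d\<^sup>2 / \<kappa> (\<Lambda> s) - 1/2) 0) (at s)"
    by (rule front_reparametrized[OF f assms(3,4)], rule that)
  obtain \<Lambda>' B' N' where \<Lambda>': "C01_on {-l0..T - L T} \<Lambda>'" "\<Lambda>' (-l0) = l0"
    "\<And>t. t \<in> {0..T} \<Longrightarrow> t - L t \<in> {-l0..T - L T} \<and> \<Lambda>' (t - L t) = L t"
    "\<And>s. s \<in> {-l0..T - L T} \<Longrightarrow> s + \<Lambda>' s \<in> {0..T} \<and> L (s + \<Lambda>' s) = \<Lambda>' s \<and> \<Lambda>' s \<in> {0..L T}"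
    "negligible N'"
    "\<And>s. s \<in> {-l0<..<T - L T} - N' \<Longrightarrow> \<exists>d. \<bar>d\<bar> \<le> B' \<and> (F has_real_derivative d) (at s) \<and>
        (\<Lambda>' has_real_derivative max (d\<^sup>2 / \<kappa> (\<Lambda>' s) - 1/2) 0) (at s)"
    by (rule front_reparametrized[OF F assms(3,4)], rule that)
  have agree: "\<Lambda> s = \<Lambda>' s" if s: "s \<in> {-l0..b}" and b: "b \<le> T - l T" "b \<le> T - L T" "b \<le> a" for b s
  proof -
    obtain K where K: "K-lipschitz_on {0..max (l T) (L T)} \<kappa>" using lipschitz_on_Icc by blast
    obtain M M' where "M-lipschitz_on {-l0..T - l T} \<Lambda>" "M'-lipschitz_on {-l0..T - L T} \<Lambda>'"
      using \<Lambda>(1) \<Lambda>'(1) unfolding C01_on_def by blast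
    then have M: "M-lipschitz_on {-l0..b} \<Lambda>" and M': "M'-lipschitz_on {-l0..b} \<Lambda>'"
      using b by (auto elim: lipschitz_on_subset)
    have "\<Lambda> s - \<Lambda>' s = 0"
    proof (rule gronwall_AE_zero[OF lipschitz_on_diff[OF M M'] _ _ _ s])
      show "negligible (N \<union> N')" using \<Lambda> \<Lambda>' by simp
      show "\<Lambda> (- l0) - \<Lambda>' (- l0) = 0" using \<Lambda> \<Lambda>' by simp
      fix s assume s: "s \<in> {-l0<..<b} - (N \<union> N')"
      obtain d where d: "\<bar>d\<bar> \<le> B" "(f has_real_derivative d) (at s)"
        "(\<Lambda> has_real_derivative max (d\<^sup>2 / \<kappa> (\<Lambda> s) - 1/2) 0) (at s)" using \<Lambda>(6)[of s] s b by auto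
      obtain d' where d': "(F has_real_derivative d') (at s)"
        "(\<Lambda>' has_real_derivative max (d'\<^sup>2 / \<kappa> (\<Lambda>' s) - 1/2) 0) (at s)" using \<Lambda>'(6)[of s] s b by auto
      have "0 < l T" using front_pos[OF f, of T] \<open>0 < T\<close> by simp
      then have "\<forall>\<^sub>F y in nhds s. y \<in> {-l0<..<b}" using s by (intro eventually_nhds_in_open) auto
      then have "\<forall>\<^sub>F y in nhds s. f y = F y"
        by eventually_elim (use b eq \<open>0 < l T\<close> in auto)
      then have "(F has_real_derivative d) (at s)" using d(2) DERIV_cong_ev[of s s f F d d] by simp
      then have "d' = d" using d' DERIV_unique by blast
      have in1: "\<Lambda> s \<in> {0..max (l T) (L T)}" "\<Lambda>' s \<in> {0..max (l T) (L T)}"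
        using \<Lambda>(4)[of s] \<Lambda>'(4)[of s] s b by auto
      define k k' where "k = \<kappa> (\<Lambda> s)" and "k' = \<kappa> (\<Lambda>' s)"
      have kk: "c1 \<le> k" "c1 \<le> k'" using in1 lower by (auto simp: k_def k'_def)
      have kd: "\<bar>k - k'\<bar> \<le> K * \<bar>\<Lambda> s - \<Lambda>' s\<bar>"
        using lipschitz_onD[OF K in1] by (simp add: dist_real_def k_def k'_def)
      \<comment> \<open>Cutting off at 0 does not increase distances. With
        \<open>\<bar>d\<bar> \<le> B\<close>, \<open>\<kappa> \<ge> c1\<close> and the Lipschitz
        constant \<open>K\<close> of \<open>\<kappa>\<close>, the Gronwall constant becomes
        \<open>B\<^sup>2 * K / (c1 * c1)\<close>.\<close>
      have "\<bar>max (d\<^sup>2 / k - 1/2) 0 - max (d\<^sup>2 / k' - 1/2) 0\<bar> \<le> \<bar>d\<^sup>2 / k - d\<^sup>2 / k'\<bar>" by linarith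
      also have "d\<^sup>2 / k - d\<^sup>2 / k' = d\<^sup>2 * (k' - k) / (k * k')" using kk c1_pos by (simp add: field_simps)
      also have "\<bar>\<dots>\<bar> = d\<^sup>2 * \<bar>k - k'\<bar> / (k * k')" using kk c1_pos by (simp add: abs_mult abs_minus_commute)
      also have "\<dots> \<le> B\<^sup>2 * (K * \<bar>\<Lambda> s - \<Lambda>' s\<bar>) / (c1 * c1)"
      proof (rule frac_le)
        have "d\<^sup>2 \<le> B\<^sup>2" using d(1) by (metis abs_le_square_iff abs_ge_zero order_trans abs_of_nonneg)
        then show "d\<^sup>2 * \<bar>k - k'\<bar> \<le> B\<^sup>2 * (K * \<bar>\<Lambda> s - \<Lambda>' s\<bar>)" using kd by (intro mult_mono) auto
        show "c1 * c1 \<le> k * k'" using kk c1_pos by (intro mult_mono) auto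
        show "0 \<le> B\<^sup>2 * (K * \<bar>\<Lambda> s - \<Lambda>' s\<bar>)" using lipschitz_on_nonneg[OF K] by simp
      qed (use c1_pos in auto)
      also have "\<dots> = (B\<^sup>2 * K / (c1 * c1)) * \<bar>\<Lambda> s - \<Lambda>' s\<bar>" by simp
      finally show "\<exists>d. ((\<lambda>s. \<Lambda> s - \<Lambda>' s) has_real_derivative d) (at s) \<and>
          \<bar>d\<bar> \<le> (B\<^sup>2 * K / (c1 * c1)) * \<bar>\<Lambda> s - \<Lambda>' s\<bar>"
        using DERIV_diff[OF d(3) d'(2)] unfolding \<open>d' = d\<close> k_def k'_def by blast
    qed
    then show ?thesis by simp
  qed
  show ?thesis
  proof (cases "t - l t \<le> T - L T")
    case True
    have "t - l t \<in> {-l0..T - l T}" using \<Lambda>(3) t by blast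
    then have "\<Lambda>' (t - l t) = l t" using agree[of "t - l t" "t - l t"] \<Lambda>(3)[OF t(1)] True t by auto
    then show ?thesis using \<Lambda>'(4)[of "t - l t"] True \<open>t - l t \<in> {-l0..T - l T}\<close> by auto
  next
    \<comment> \<open>Here \<open>t - l t\<close> lies beyond the last characteristic met by
      \<open>L\<close>. Agreement at \<open>T - L T\<close> forces \<open>l T = L T\<close>, and
      then \<open>t - l t\<close> exceeds \<open>T - l T\<close>, which is impossible.\<close>
    case False
    then have b: "T - L T \<le> T - l T" "T - L T \<le> a" using \<Lambda>(3)[OF t(1)] t by auto
    have T: "T \<in> {0..T}" using \<open>0 < T\<close> by simp
    have "\<Lambda> (T - L T) = L T" using agree[of "T - L T" "T - L T"] \<Lambda>'(3)[OF T] b by auto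
    then have "l T = L T" using \<Lambda>(4)[of "T - L T"] \<Lambda>'(3)[OF T] b by auto
    then show ?thesis using False \<Lambda>(3)[OF t(1)] by auto
  qed
qed

section \<open>Geometry of the characteristics and their reflection at the front\<close>

lemma front_mono:
  assumes "front l0 T f l" "0 < T" "0 < l0" and st: "0 \<le> s" "s \<le> t" "t \<le> T"
  shows "l s \<le> l t" "s - l s \<le> t - l t"
proof -
  obtain c B N where "0 < c"
    and m: "\<And>s t. 0 \<le> s \<Longrightarrow> s \<le> t \<Longrightarrow> t \<le> T \<Longrightarrow> l s \<le> l t"
    and sl: "\<And>s t. 0 \<le> s \<Longrightarrow> s \<le> t \<Longrightarrow> t \<le> T \<Longrightarrow> c * (t - s) \<le> (t - l t) - (s - l s)"
    by (rule front_ode[OF assms(1-3)], rule that)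
  show "l s \<le> l t" using m st .
  have "0 \<le> c * (t - s)" using \<open>0 < c\<close> st by simp
  then show "s - l s \<le> t - l t" using sl[OF st] by linarith
qed

lemma front_char_bounds:
  assumes "front l0 T f l" "0 < T" "0 < l0" and "t \<in> {0..T}" "x \<in> {0..l t}"
  shows "t - x \<in> {-l0..T}" "t + x \<in> {0..T + l T}"
  using front_mono[OF assms(1-3), of 0 t] front_mono[OF assms(1-3), of t T] assms
  by (auto simp: front_def)

lemma reflect_front:
  assumes "front l0 T f l" "0 < T" "0 < l0" and t: "t \<in> {0..T}"
  shows "reflect T l (t + l t) = t - l t"
proof -
  have "inj_on (\<lambda>t. t + l t) {0..T}"
  proof (rule inj_onI)
    fix x y assume "x \<in> {0..T}" "y \<in> {0..T}" "x + l x = y + l y"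
    then show "x = y" using front_mono(1)[OF assms(1-3), of x y] front_mono(1)[OF assms(1-3), of y x]
      by (cases "x \<le> y") auto
  qed
  then show ?thesis unfolding reflect_def Let_def using the_inv_into_f_f t by fastforce
qed

lemma front_char_surj:
  assumes "front l0 T f l" "0 < T" and s: "s \<in> {l0..T + l T}"
  obtains t where "t \<in> {0..T}" "s = t + l t"
proof -
  obtain L where "L-lipschitz_on {0..T} l" using assms by (auto simp: front_def C01_on_def)
  then have "continuous_on {0..T} (\<lambda>t. t + l t)"
    by (intro continuous_intros lipschitz_on_continuous_on)
  then have "\<exists>t\<ge>0. t \<le> T \<and> t + l t = s"
    using assms by (intro IVT') (auto simp: front_def)
  then show ?thesis using that by auto
qed

text \<open>The two characteristics through the front at time \<open>t\<close> differ by
  \<open>2 * l t\<close>, and the front never falls below its initial length. This delay drives the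
  induction for uniqueness.\<close>

lemma reflect_front_range:
  assumes f: "front l0 T f l" "0 < T" "0 < l0" and s: "s \<in> {l0..T + l T}"
  shows "reflect T l s \<in> {-l0..T}" "reflect T l s \<le> s - 2 * l0"
proof -
  obtain t where t: "t \<in> {0..T}" "s = t + l t" using front_char_surj[OF f(1,2) s] .
  have r: "reflect T l s = t - l t" using reflect_front[OF f t(1)] t(2) by simp
  have m: "l0 \<le> l t" using front_mono(1)[OF f, of 0 t] t f(1) by (simp add: front_def)
  then show "reflect T l s \<le> s - 2 * l0" using r t by simp
  show "reflect T l s \<in> {-l0..T}" 
    unfolding r by (rule front_char_bounds[OF f t(1)]) (use m f in auto)
qed

text \<open>For a nondecreasing front, \<open>\<tau>\<^sub>-\<close> moves at most as fast as \<open>\<tau>\<^sub>+\<close>.\<close>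
lemma reflect_front_lipschitz:
  assumes f: "front l0 T f l" "0 < T" "0 < l0"
  shows "1-lipschitz_on {l0..T + l T} (reflect T l)"
proof (rule lipschitz_onI)
  fix s s' assume "s \<in> {l0..T + l T}" "s' \<in> {l0..T + l T}"
  then obtain t t' where t: "t \<in> {0..T}" "s = t + l t" and t': "t' \<in> {0..T}" "s' = t' + l t'"
    using front_char_surj[OF f(1,2)] by metis
  have "reflect T l s = t - l t" "reflect T l s' = t' - l t'"
    using reflect_front[OF f] t t' by auto
  then show "dist (reflect T l s) (reflect T l s') \<le> 1 * dist s s'"
    using front_mono[OF f, of t t'] front_mono[OF f, of t' t] t t'
    by (cases "t \<le> t'") (auto simp: dist_real_def abs_if)
qed auto

section \<open>Solutions of the debonding system\<close>

lemma C01_solution_front: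
  assumes "C01_solution \<kappa> l0 y0 y1 T u l y"
  obtains f g where "front l0 T f l"
    "\<And>s. s \<in> {-l0..0} \<Longrightarrow> f s = 1/2 * integral {0..-s} (\<lambda>\<sigma>. D_on 0 l0 y0 \<sigma> - y1 \<sigma>)"
    "\<And>s. s \<in> {0<..l0} \<Longrightarrow> s \<le> T \<Longrightarrow> f s = u s - u 0 - 1/2 * integral {0..s} (\<lambda>\<sigma>. D_on 0 l0 y0 \<sigma> + y1 \<sigma>)"
    "\<And>s. s \<in> {l0<..T} \<Longrightarrow> f s = u s + f (reflect T l s)"
    "\<And>s. s \<in> {0..l0} \<Longrightarrow> g s = - u 0 - 1/2 * integral {0..s} (\<lambda>\<sigma>. D_on 0 l0 y0 \<sigma> + y1 \<sigma>)"
    "\<And>s. s \<in> {l0<..T + l T} \<Longrightarrow> g s = f (reflect T l s)"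
    "\<And>t x. t \<in> {0..T} \<Longrightarrow> x \<in> {0..l t} \<Longrightarrow> y t x = f (t - x) - g (t + x)"
  using assms unfolding C01_solution_def
proof (elim conjE exE, goal_cases)
  case (1 f g)
  show ?case
  proof (rule that[of f g])
    show "front l0 T f l" using 1 by (simp add: front_def front_speed_def)
  qed (use 1 in auto)
qed

lemma C01_solution_unique:
  assumes sol: "C01_solution \<kappa> l0 y0 y1 T u l y" "C01_solution \<kappa> l0 y0 y1 T u L Y"
    and "0 < T" "0 < l0" and t: "t \<in> {0..T}"
  shows "l t = L t" and "\<And>x. x \<in> {0..l t} \<Longrightarrow> y t x = Y t x"
proof -
  obtain f g where f: "front l0 T f l"
    "\<And>s. s \<in> {-l0..0} \<Longrightarrow> f s = 1/2 * integral {0..-s} (\<lambda>\<sigma>. D_on 0 l0 y0 \<sigma> - y1 \<sigma>)"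
    "\<And>s. s \<in> {0<..l0} \<Longrightarrow> s \<le> T \<Longrightarrow> f s = u s - u 0 - 1/2 * integral {0..s} (\<lambda>\<sigma>. D_on 0 l0 y0 \<sigma> + y1 \<sigma>)"
    "\<And>s. s \<in> {l0<..T} \<Longrightarrow> f s = u s + f (reflect T l s)"
    "\<And>s. s \<in> {0..l0} \<Longrightarrow> g s = - u 0 - 1/2 * integral {0..s} (\<lambda>\<sigma>. D_on 0 l0 y0 \<sigma> + y1 \<sigma>)"
    "\<And>s. s \<in> {l0<..T + l T} \<Longrightarrow> g s = f (reflect T l s)"
    "\<And>t x. t \<in> {0..T} \<Longrightarrow> x \<in> {0..l t} \<Longrightarrow> y t x = f (t - x) - g (t + x)"
    by (rule C01_solution_front[OF sol(1)], rule that)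
  obtain F G where F: "front l0 T F L"
    "\<And>s. s \<in> {-l0..0} \<Longrightarrow> F s = 1/2 * integral {0..-s} (\<lambda>\<sigma>. D_on 0 l0 y0 \<sigma> - y1 \<sigma>)"
    "\<And>s. s \<in> {0<..l0} \<Longrightarrow> s \<le> T \<Longrightarrow> F s = u s - u 0 - 1/2 * integral {0..s} (\<lambda>\<sigma>. D_on 0 l0 y0 \<sigma> + y1 \<sigma>)"
    "\<And>s. s \<in> {l0<..T} \<Longrightarrow> F s = u s + F (reflect T L s)"
    "\<And>s. s \<in> {0..l0} \<Longrightarrow> G s = - u 0 - 1/2 * integral {0..s} (\<lambda>\<sigma>. D_on 0 l0 y0 \<sigma> + y1 \<sigma>)"
    "\<And>s. s \<in> {l0<..T + L T} \<Longrightarrow> G s = F (reflect T L s)"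
    "\<And>t x. t \<in> {0..T} \<Longrightarrow> x \<in> {0..L t} \<Longrightarrow> Y t x = F (t - x) - G (t + x)"
    by (rule C01_solution_front[OF sol(2)], rule that)
  note ff = f(1) \<open>0 < T\<close> \<open>0 < l0\<close> and FF = F(1) \<open>0 < T\<close> \<open>0 < l0\<close>
  have lT: "0 < l T" using front_pos[OF f(1), of T] \<open>0 < T\<close> by simp
  \<comment> \<open>Each step of the induction advances by the delay \<open>2 * l0\<close>. For
    \<open>s > l0\<close> the formula for \<open>f\<close> refers to its value at some
    \<open>t - l t\<close> already covered; there \<open>front_unique\<close> gives
    \<open>l t = L t\<close>, so both solutions reflect \<open>s\<close> to the same point.\<close>
  have agree: "f s = F s" if "s \<in> {-l0..T}" "s \<le> real n * (2 * l0)" for n s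
    using that
  proof (induction n arbitrary: s)
    case 0
    then show ?case using f(2)[of s] F(2)[of s] by simp
  next
    case (Suc n)
    note IH = Suc.IH
    consider "s \<in> {-l0..0}" | "s \<in> {0<..l0}" | "s \<in> {l0<..T}" using Suc.prems by fastforce
    then show ?case
    proof cases
      case 1
      then show ?thesis using f(2)[of s] F(2)[of s] by simp
    next
      case 2
      then show ?thesis using f(3)[of s] F(3)[of s] Suc.prems by simp
    next
      case 3
      then have s: "s \<in> {l0..T + l T}" using lT by auto
      obtain t where t: "t \<in> {0..T}" "s = t + l t" using front_char_surj[OF ff(1,2) s] .
      have r: "reflect T l s = t - l t" using reflect_front[OF ff t(1)] t(2) by simp
      have le: "t - l t \<le> real n * (2 * l0)"
        using reflect_front_range(2)[OF ff s] Suc.prems(2) r by (simp add: algebra_simps)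
      have "l t = L t" by (rule front_unique[OF f(1) F(1) \<open>0 < T\<close> \<open>0 < l0\<close> IH t(1) le])
      then have "reflect T L s = t - l t" using reflect_front[OF FF t(1)] t(2) by simp
      moreover have "f (t - l t) = F (t - l t)"
        using IH[OF _ le] reflect_front_range(1)[OF ff s] r by simp
      ultimately show ?thesis using f(4)[OF 3] F(4)[OF 3] r by simp
    qed
  qed
  obtain n where "T / (2 * l0) \<le> real n" using real_arch_simple by blast
  then have "T \<le> real n * (2 * l0)" using \<open>0 < l0\<close> by (simp add: divide_le_eq)
  then have fF: "f s = F s" if "s \<in> {-l0..T}" for s using agree[of s n] that by auto
  have lL: "l t = L t" if "t \<in> {0..T}" for t
    by (rule front_unique[OF f(1) F(1) \<open>0 < T\<close> \<open>0 < l0\<close> fF that order_refl])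
  have gG: "g s = G s" if s: "s \<in> {0..T + l T}" for s
  proof (cases "s \<le> l0")
    case False
    then have s': "s \<in> {l0..T + l T}" using s by auto
    obtain t where t: "t \<in> {0..T}" "s = t + l t" using front_char_surj[OF ff(1,2) s'] .
    have "reflect T L s = reflect T l s"
      using reflect_front[OF ff t(1)] reflect_front[OF FF t(1)] t lL[OF t(1)] by simp
    moreover have "l T = L T" using lL[of T] \<open>0 < T\<close> by simp
    ultimately show ?thesis
      using f(6)[of s] F(6)[of s] fF[OF reflect_front_range(1)[OF ff s']] s False by simp
  qed (use f(5) F(5) s in auto)
  show "l t = L t" using lL t .
  fix x assume x: "x \<in> {0..l t}"
  show "y t x = Y t x"
    using f(7)[OF t x] F(7)[OF t, of x] x lL[OF t] front_char_bounds[OF ff t x] fF gG by simp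
qed

text \<open>The formulas for \<open>f\<close> and \<open>g\<close> in \<open>C01_solution\<close>
  become definitions of \<open>u\<close> and \<open>g\<close>. What remains is continuity at
  \<open>s = l0\<close>: this characteristic is reflected to \<open>- l0\<close>, and
  \<open>compat\<close> says that the two formulas match there. In the application
  \<open>compat\<close> is the condition \<open>y0 l0 = 0\<close>. The last conclusion expresses the
  displacement by differences of \<open>F\<close>, in which additive constants cancel.\<close>

lemma front_imp_C01_solution:
  fixes y0 y1 :: "real \<Rightarrow> real" and l0 :: real
  defines "p \<equiv> \<lambda>x. integral {0..x} (\<lambda>\<sigma>. D_on 0 l0 y0 \<sigma> + y1 \<sigma>)"
  assumes F: "front l0 T F L" and "0 < l0" "l0 < T"
    and data: "\<And>s. s \<in> {-l0..0} \<Longrightarrow> F s = 1/2 * integral {0..-s} (\<lambda>\<sigma>. D_on 0 l0 y0 \<sigma> - y1 \<sigma>)"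
    and p: "C01_on {0..l0} p" and compat: "F (-l0) = - u0 - 1/2 * p l0"
  obtains u y where "C01_on {0..T} u" "u 0 = u0" "C01_solution \<kappa> l0 y0 y1 T u L y"
    "\<And>t x. t \<in> {0..T} \<Longrightarrow> x \<in> {0..L t} \<Longrightarrow> l0 < t + x \<Longrightarrow> y t x = F (t - x) - F (reflect T L (t + x))"
proof -
  have "0 < T" using assms by simp
  note FF = F \<open>0 < T\<close> \<open>0 < l0\<close>
  have LT: "0 < L T" using front_pos[OF F, of T] \<open>0 < T\<close> by simp
  define r where "r = reflect T L"
  have r0: "r l0 = - l0"
    using reflect_front[OF FF, of 0] F \<open>0 < T\<close> by (simp add: r_def front_def)
  have F0: "F 0 = 0" using data[of 0] \<open>0 < l0\<close> by simp
  have p0: "p 0 = 0" by (simp add: p_def)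
  obtain A where A: "A-lipschitz_on {-l0..T} F" using F by (auto simp: front_def C01_on_def)
  obtain P where P: "P-lipschitz_on {0..l0} p" using p by (auto simp: C01_on_def)
  have Fr: "(A * 1)-lipschitz_on {l0..T + L T} (\<lambda>s. F (r s))"
    unfolding r_def using reflect_front_range(1)[OF FF]
    by (intro lipschitz_on_compose2[OF reflect_front_lipschitz[OF FF]] lipschitz_on_subset[OF A]) auto
  have P2: "(1/2 * P)-lipschitz_on {0..l0} (\<lambda>s. 1/2 * p s)"
    using lipschitz_on_cmult_real[OF P, of "1/2"] by simp
  \<comment> \<open>Since \<open>F 0 = 0\<close> and \<open>p 0 = 0\<close>, the first branch has
    \<open>u 0 = u0\<close>, so the term \<open>u 0\<close> in the formula for \<open>f\<close> is
    consistent with the definition.\<close>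
  define u where "u s = (if s \<le> l0 then F s + (u0 + 1/2 * p s) else F s - F (r s))" for s
  define g where "g s = (if s \<le> l0 then - u0 - 1/2 * p s else F (r s))" for s
  define y where "y t x = F (t - x) - g (t + x)" for t x
  have uC: "C01_on {0..T} u"
    unfolding C01_on_def u_def
  proof (rule exI, rule lipschitz_on_concat_max)
    show "(A + (0 + 1/2 * P))-lipschitz_on {0..l0} (\<lambda>s. F s + (u0 + 1/2 * p s))"
      by (intro lipschitz_on_add lipschitz_on_constant P2 lipschitz_on_subset[OF A]) (use assms in auto)
    show "(A + A * 1)-lipschitz_on {l0..T} (\<lambda>s. F s - F (r s))"
      by (intro lipschitz_on_diff lipschitz_on_subset[OF A] lipschitz_on_subset[OF Fr]) (use assms LT in auto)
    show "F l0 + (u0 + 1/2 * p l0) = F l0 - F (r l0)" using compat r0 by simp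
  qed
  obtain M where M: "M-lipschitz_on {0..T + L T} g"
  proof -
    have "(max (0 + 1/2 * P) (A * 1))-lipschitz_on {0..T + L T} g"
      unfolding g_def
    proof (rule lipschitz_on_concat_max[OF _ Fr])
      show "(0 + 1/2 * P)-lipschitz_on {0..l0} (\<lambda>s. - u0 - 1/2 * p s)"
        by (intro lipschitz_on_diff lipschitz_on_constant P2)
      show "- u0 - 1/2 * p l0 = F (r l0)" using compat r0 by simp
    qed
    then show ?thesis using that by blast
  qed
  let ?D = "{(t, x). 0 \<le> t \<and> t \<le> T \<and> 0 \<le> x \<and> x \<le> L t}"
  have pm: "2-lipschitz_on S (\<lambda>z. fst z - snd z)" "2-lipschitz_on S (\<lambda>z. fst z + snd z)"
    for S :: "(real \<times> real) set"
  proof -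
    have "\<bar>fst z - fst w\<bar> + \<bar>snd z - snd w\<bar> \<le> 2 * dist z w" for z w :: "real \<times> real"
      using dist_fst_le[of z w] dist_snd_le[of z w] by (simp add: dist_real_def)
    note * = order_trans[OF _ this]
    show "2-lipschitz_on S (\<lambda>z. fst z - snd z)" "2-lipschitz_on S (\<lambda>z. fst z + snd z)"
      by (intro lipschitz_onI *; simp add: dist_real_def)+
  qed
  have yC: "C01_on ?D (\<lambda>(t, x). y t x)"
  proof -
    have "(A * 2)-lipschitz_on ?D (\<lambda>z. F (fst z - snd z))"
      by (rule lipschitz_on_compose2[OF pm(1) lipschitz_on_subset[OF A]])
         (use front_char_bounds(1)[OF FF] in auto)
    moreover have "(M * 2)-lipschitz_on ?D (\<lambda>z. g (fst z + snd z))"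
      by (rule lipschitz_on_compose2[OF pm(2) lipschitz_on_subset[OF M]])
         (use front_char_bounds(2)[OF FF] in auto)
    ultimately have "(A * 2 + M * 2)-lipschitz_on ?D (\<lambda>z. F (fst z - snd z) - g (fst z + snd z))"
      by (rule lipschitz_on_diff)
    then show ?thesis unfolding C01_on_def y_def by (auto simp: case_prod_beta)
  qed
  have u0: "u 0 = u0" using \<open>0 < l0\<close> F0 p0 by (simp add: u_def)
  have "C01_solution \<kappa> l0 y0 y1 T u L y"
    unfolding C01_solution_def
  proof (intro conjI; (rule exI[of _ F], rule exI[of _ g], intro conjI)?)
    show "AE t\<in>{0..T} in lebesgue. \<exists>d. (F has_real_derivative d) (at (t - L t) within {-l0..T}) \<and>
        (L has_real_derivative max ((2 * d\<^sup>2 - \<kappa> (L t)) / (2 * d\<^sup>2 + \<kappa> (L t))) 0) (at t within {0..T})"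
      using F by (simp add: front_def front_speed_def)
    show "\<forall>s\<in>{0<..l0}. s \<le> T \<longrightarrow> F s = u s - u 0 - 1/2 * integral {0..s} (\<lambda>\<sigma>. D_on 0 l0 y0 \<sigma> + y1 \<sigma>)"
      by (simp add: u0) (simp add: u_def p_def)
    show "\<forall>s\<in>{l0<..T}. F s = u s + F (reflect T L s)" by (simp add: u_def r_def)
    show "\<forall>s\<in>{0..l0}. g s = - u 0 - 1/2 * integral {0..s} (\<lambda>\<sigma>. D_on 0 l0 y0 \<sigma> + y1 \<sigma>)"
      by (simp add: u0) (simp add: g_def p_def)
    show "\<forall>s\<in>{l0<..T + L T}. g s = F (reflect T L s)" by (simp add: g_def r_def)
    show "C01_on ?D (\<lambda>(t, x). y t x)" by (rule yC)
    show "\<forall>t\<in>{0..T}. \<forall>x\<in>{0..L t}. y t x = F (t - x) - g (t + x)" by (simp add: y_def)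
  qed (use F data in \<open>auto simp: front_def\<close>)
  moreover have "y t x = F (t - x) - F (reflect T L (t + x))" if "l0 < t + x" for t x
    using that by (simp add: y_def g_def r_def)
  ultimately show ?thesis using that uC u0 by blast
qed

section \<open>The initial branch and the steered front\<close>

text \<open>The wave that meets the initial branch has derivative \<open>w / 2\<close> with
  \<open>w\<close> the value of \<open>y1 - y0'\<close>, so the branch equation is an instance of
  the front equation.\<close>

lemma front_speed_half: "front_speed (w / 2) k = max ((1/2 * w\<^sup>2 - k) / (1/2 * w\<^sup>2 + k)) 0"
  by (simp add: front_speed_def power_divide)

text \<open>The branch equation contains that \<open>y0\<close> is differentiable almost everywhere, since \<open>l t - t\<close>
  sweeps \<open>[0, l0]\<close>.\<close>
lemma initial_branch:
  assumes branch: "initial_branch_end \<kappa> l0 y0 y1 s" and "0 < l0"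
    and y0: "C01_on {0..l0} y0" and y1: "Linf_on 0 l0 y1"
  defines "f \<equiv> \<lambda>x. 1/2 * (y0 (-x) - y0 0 - integral {0..-x} y1)"
  obtains l N where "0 < s" "C01_on {0..s} l" "l 0 = l0" "l s = s"
    "\<And>t. t \<in> {0..s} \<Longrightarrow> l0 \<le> l t" "negligible N"
    "\<And>t. t \<in> {0<..<s} - N \<Longrightarrow> t - l t \<in> {-l0<..<0} \<and>
       (\<exists>d. (f has_real_derivative d) (at (t - l t)) \<and>
            (l has_real_derivative front_speed d (\<kappa> (l t))) (at t))"
    "D_on 0 l0 y0 integrable_on {0..l0}"
    "\<And>x. x \<in> {0..l0} \<Longrightarrow> integral {0..x} (D_on 0 l0 y0) = y0 x - y0 0"
proof -
  obtain l where s: "0 < s" and lC: "C01_on {0..s} l" and l: "l 0 = l0" "l s = s"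
    and ae: "AE t\<in>{0..s} in lebesgue. \<exists>d. (y0 has_real_derivative d) (at (l t - t) within {0..l0}) \<and>
       (l has_real_derivative front_speed ((y1 (l t - t) - d) / 2) (\<kappa> (l t))) (at t within {0..s})"
    using branch unfolding initial_branch_end_def Let_def front_speed_half by blast
  obtain N where N: "negligible N" and ode: "\<And>t. t \<in> {0..s} - N \<Longrightarrow> \<exists>d. (y0 has_real_derivative d) (at (l t - t) within {0..l0}) \<and>
       (l has_real_derivative front_speed ((y1 (l t - t) - d) / 2) (\<kappa> (l t))) (at t within {0..s})"
    using ae unfolding AE_lebesgue_on_iff_negligible by blast
  have ode': "\<exists>d. (y0 has_real_derivative d) (at (l t - t) within {0..l0}) \<and>
       (l has_real_derivative front_speed ((y1 (l t - t) - d) / 2) (\<kappa> (l t))) (at t)"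
    if t: "t \<in> {0<..<s} - N" for t
  proof -
    have "t \<in> {0..s} - N" using t by auto
    moreover have "at t within {0..s} = at t" using t by (simp add: at_within_Icc_at)
    ultimately show ?thesis using ode[of t] by simp
  qed
  have lge: "l0 \<le> l t" if t: "t \<in> {0..s}" for t
  proof -
    have "0 * (t - 0) \<le> l t - l 0"
    proof (rule C01_on_AE_deriv_ge[OF lC N])
      fix t assume "t \<in> {0<..<s} - N"
      then obtain p where "(l has_real_derivative front_speed p (\<kappa> (l t))) (at t)" using ode' by blast
      moreover have "0 \<le> front_speed p (\<kappa> (l t))" by (simp add: front_speed_def)
      ultimately show "\<exists>d\<ge>0. (l has_real_derivative d) (at t)" by blast
    qed (use t in auto)
    then show ?thesis using l by simp
  qed
  have speed: "0 \<le> front_speed d (\<kappa> (l t)) \<and> front_speed d (\<kappa> (l t)) < 1" if "t \<in> {0..s}" for d t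
    using front_speed_bounds[OF pos, of "l t" d] lge[OF that] \<open>0 < l0\<close> by simp
  have weak: "\<exists>p. 0 \<le> p \<and> p < 1 \<and> (l has_real_derivative p) (at t)" if t: "t \<in> {0<..<s} - N" for t
  proof -
    obtain p where "(l has_real_derivative front_speed p (\<kappa> (l t))) (at t)" using ode'[OF t] by blast
    moreover have "t \<in> {0..s}" using t by auto
    ultimately show ?thesis using speed by blast
  qed
  note mono = C01_on_slope_less_1_mono[OF lC N weak]
  have \<theta>: "t - l t \<in> {-l0..0}" if "t \<in> {0..s}" for t
    using mono(2)[of 0 t] mono(2)[of t s] that l by simp
  obtain L where L: "L-lipschitz_on {0..s} l" using lC by (auto simp: C01_on_def)
  have xL: "(L + 1)-lipschitz_on {0..s} (\<lambda>t. l t - t)" by (rule lipschitz_on_diff[OF L lipschitz_on_id])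
  obtain A where A: "A-lipschitz_on {0..l0} y0" using y0 by (auto simp: C01_on_def)
  \<comment> \<open>Any point of the open interval outside \<open>M0\<close> is
    \<open>l t - t\<close> for a good time \<open>t\<close>; so \<open>y0\<close> is differentiable
    there, \<open>D_on\<close> is its true derivative, and integrating \<open>D_on\<close> gives
    back \<open>y0\<close>.\<close>
  define M0 where "M0 = (\<lambda>t. l t - t) ` (N \<inter> {0..s})"
  have M0: "negligible M0"
    unfolding M0_def by (rule negligible_lipschitz_image[OF xL]) (use N in \<open>auto intro: negligible_subset\<close>)
  have D: "(y0 has_real_derivative D_on 0 l0 y0 x) (at x)" if x: "x \<in> {0<..<l0} - M0" for x
  proof -
    have "\<exists>t\<ge>0. t \<le> s \<and> l t - t = x"
      by (rule IVT2') (use x l s lipschitz_on_continuous_on[OF xL] in auto)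
    then obtain t where t: "t \<in> {0..s}" "l t - t = x" by auto
    then have "t \<notin> N" using x by (auto simp: M0_def)
    then obtain d where "(y0 has_real_derivative d) (at x within {0..l0})" using ode[of t] t by blast
    moreover have "at x within {0..l0} = at x" using x by (simp add: at_within_Icc_at)
    ultimately show ?thesis
      unfolding D_on_def by (auto simp: has_real_derivative_iff_has_vector_derivative vector_derivative_at)
  qed
  note FTC = lipschitz_AE_FTC[OF A M0 D]
  obtain M1 where M1: "negligible M1"
    "\<And>x. x \<in> {0<..<l0} - M1 \<Longrightarrow> ((\<lambda>x. integral {0..x} y1) has_real_derivative y1 x) (at x)"
    using indefinite_integral_deriv_AE[OF Linf_on_integrable[OF y1]] by blast
  define M where "M = insert 0 (insert l0 (M0 \<union> M1))"
  \<comment> \<open>Times at which the characteristic starts from a bad point of the data. The speed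
    is bounded below 1 only pointwise here, so \<open>E\<close> is null because
    \<open>l t - t\<close> has nonzero derivative on it, without a Lipschitz inverse.\<close>
  define E where "E = {t \<in> {0<..<s} - N. l t - t \<in> M}"
  have E: "negligible E"
  proof (rule negligible_deriv_nonzero_preimage)
    show "\<exists>d. d \<noteq> 0 \<and> ((\<lambda>t. l t - t) has_real_derivative d) (at t)" if t: "t \<in> E" for t
    proof -
      obtain p where "p < 1" "(l has_real_derivative p) (at t)" using weak[of t] t by (auto simp: E_def)
      then show ?thesis by (intro exI[of _ "p - 1"]) (auto intro!: derivative_eq_intros)
    qed
    show "negligible ((\<lambda>t. l t - t) ` E)"
      by (rule negligible_subset[of M]) (use M0 M1 in \<open>auto simp: M_def E_def\<close>)
  qed
  show ?thesis
  proof (rule that[OF s lC l lge _ _ FTC])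
    show "negligible (N \<union> E)" using N E by simp
    fix t assume t: "t \<in> {0<..<s} - (N \<union> E)"
    then have t': "t \<in> {0..s}" "t \<in> {0<..<s} - N" by auto
    define x where "x = l t - t"
    have "x \<notin> M" using t by (auto simp: E_def x_def)
    then have x: "x \<in> {0<..<l0}" "x \<notin> M0" "x \<notin> M1" using \<theta>[OF t'(1)] by (auto simp: M_def x_def)
    obtain d where d: "(y0 has_real_derivative d) (at x within {0..l0})"
       "(l has_real_derivative front_speed ((y1 x - d) / 2) (\<kappa> (l t))) (at t)"
      using ode'[OF t'(2)] unfolding x_def by blast
    have "at x within {0..l0} = at x" using x by (simp add: at_within_Icc_at)
    then have y0x: "(y0 has_real_derivative d) (at (- (t - l t)))" using d(1) by (simp add: x_def)
    have y1x: "((\<lambda>x. integral {0..x} y1) has_real_derivative y1 x) (at (- (t - l t)))"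
      using M1(2)[of x] x by (simp add: x_def)
    note DERIV_cmult[OF DERIV_diff[OF DERIV_diff[OF iffD1[OF DERIV_mirror y0x] DERIV_const]
          iffD1[OF DERIV_mirror y1x]], of "1/2" "y0 0"]
    then have "(f has_real_derivative (y1 x - d) / 2) (at (t - l t))"
      unfolding f_def by (simp add: diff_divide_distrib)
    moreover have "t - l t \<in> {-l0<..<0}" using x by (auto simp: x_def)
    ultimately show "t - l t \<in> {-l0<..<0} \<and> (\<exists>d. (f has_real_derivative d) (at (t - l t)) \<and>
            (l has_real_derivative front_speed d (\<kappa> (l t))) (at t))" using d(2) by blast
  qed
qed

text \<open>Between \<open>s\<close> and \<open>T - b\<close> the front is moved linearly, with slope \<open>m / (1 + m)\<close> in \<open>t\<close> and
  slope \<open>m\<close> in the variable \<open>t - l t\<close>; solving the front equation for \<open>f'\<close> gives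
  \<open>(f')\<^sup>2 = \<kappa> (1 + 2 m) / 2\<close> there.\<close>
lemma front_steering:
  assumes "0 < l0" "0 < s" "s \<le> b" "2 * b < T"
    and l: "C01_on {0..s} l" "l 0 = l0" "l s = s" "\<And>t. t \<in> {0..s} \<Longrightarrow> 0 < l t"
    and f: "C01_on {-l0..0} f" "f 0 = 0"
    and N: "negligible N"
    and ode: "\<And>t. t \<in> {0<..<s} - N \<Longrightarrow> t - l t \<in> {-l0<..<0} \<and>
       (\<exists>d. (f has_real_derivative d) (at (t - l t)) \<and>
            (l has_real_derivative front_speed d (\<kappa> (l t))) (at t))"
    and \<phi>: "C01_on {T - 2 * b..T} \<phi>" and N': "negligible N'"
    and der\<phi>: "\<And>x. x \<in> {T - 2 * b<..<T - b} - N' \<Longrightarrow> \<exists>d. (\<phi> has_real_derivative d) (at x) \<and> 2 * d\<^sup>2 \<le> \<kappa> b"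
  obtains F L c where "front l0 T F L" "\<And>x. x \<in> {-l0..0} \<Longrightarrow> F x = f x"
    "\<And>x. x \<in> {T - 2 * b..T} \<Longrightarrow> F x = \<phi> x + c" "\<And>t. t \<in> {T - b..T} \<Longrightarrow> L t = b"
proof -
  \<comment> \<open>The value of \<open>t - L t\<close> when the front arrives at \<open>b\<close>
    at time \<open>T - b\<close>. At time \<open>s\<close> that value is 0, as
    \<open>l s = s\<close>; so the transport takes place for characteristics in
    \<open>[0, S]\<close>, and \<open>m\<close> below is the required growth per unit of this
    variable.\<close>
  define S where "S = T - 2 * b"
  have S: "0 < S" using assms by (simp add: S_def)
  define m where "m = (b - s) / S"
  have m: "0 \<le> m" using assms S by (simp add: m_def)
  have mS: "m * S = b - s" using S by (simp add: m_def)
  have Sm: "(1 + m) * S = T - b - s" using mS by (simp add: S_def algebra_simps)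
  define L1 where "L1 t = s + (t - s) * (m / (1 + m))" for t
  define L where "L t = (if t \<le> s then l t else if t \<le> T - b then L1 t else b)" for t
  have L1end: "L1 s = s" "L1 (T - b) = b"
  proof -
    have "(T - b - s) * (m / (1 + m)) = (1 + m) * S * (m / (1 + m))" by (simp only: Sm)
    also have "\<dots> = m * S" using m by simp
    finally show "L1 (T - b) = b" using mS by (simp add: L1_def)
  qed (simp add: L1_def)
  have L1\<theta>: "t - L1 t = (t - s) / (1 + m)" "L1 t = s + m * (t - L1 t)" for t
    using m by (simp_all add: L1_def field_simps)
  have L1ge: "s \<le> L1 t" if "s \<le> t" for t using that m by (simp add: L1_def)
  define h where "h x = sqrt (\<kappa> (s + m * x) * (1 + 2 * m) / 2)" for x
  define f1 where "f1 x = integral {0..x} h" for x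
  define c where "c = f1 S - \<phi> S"
  define F where "F x = (if x \<le> 0 then f x else if x \<le> S then f1 x else \<phi> x + c)" for x
  have hc: "continuous_on {0..S} h"
  proof -
    obtain K where K: "K-lipschitz_on {0..b} \<kappa>" using lipschitz_on_Icc by blast
    have "s + m * x \<in> {0..b}" if "x \<in> {0..S}" for x
      using that m mult_left_mono[of x S m] mS \<open>0 < s\<close> by auto
    then have "continuous_on {0..S} (\<lambda>x. \<kappa> (s + m * x))"
      by (intro continuous_on_compose2[OF lipschitz_on_continuous_on[OF K]] continuous_intros) auto
    then show ?thesis unfolding h_def by (intro continuous_intros) auto
  qed
  have f1d: "(f1 has_real_derivative h x) (at x within {0..S})" if "x \<in> {0..S}" for x
    unfolding f1_def using integral_has_real_derivative[OF hc that] .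
  obtain A1 where A1: "A1-lipschitz_on {0..S} f1" using C1_imp_lipschitz[OF f1d hc] by blast
  obtain A0 A2 where A0: "A0-lipschitz_on {-l0..0} f" and A2: "A2-lipschitz_on {S..T} \<phi>"
    using f \<phi> by (auto simp: C01_on_def S_def)
  have FC: "C01_on {-l0..T} F"
    unfolding C01_on_def F_def
    by (rule exI, (rule lipschitz_on_concat_max[OF A0 lipschitz_on_concat_max[OF A1 lipschitz_on_add[OF A2 lipschitz_on_constant]]]))
       (use S f in \<open>auto simp: c_def f1_def\<close>)
  obtain B0 where B0: "B0-lipschitz_on {0..s} l" using l by (auto simp: C01_on_def)
  have B1: "(m / (1 + m))-lipschitz_on X L1" for X
  proof (rule lipschitz_onI)
    fix x y
    have "L1 x - L1 y = (m / (1 + m)) * (x - y)" by (simp add: L1_def algebra_simps diff_divide_distrib)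
    then show "dist (L1 x) (L1 y) \<le> m / (1 + m) * dist x y" using m by (simp add: dist_real_def abs_mult)
  qed (use m in simp)
  have LC: "C01_on {0..T} L"
    unfolding C01_on_def L_def
    by (rule exI, (rule lipschitz_on_concat_max[OF B0 lipschitz_on_concat_max[OF B1 lipschitz_on_constant]]))
       (use l L1end assms in auto)
  have "front l0 T F L"
    unfolding front_def AE_lebesgue_on_iff_negligible
  proof (intro conjI FC LC)
    show "L 0 = l0" using l \<open>0 < s\<close> by (simp add: L_def)
    show "\<forall>t\<in>{0..T}. 0 < L t"
    proof
      fix t assume "t \<in> {0..T}"
      then show "0 < L t" using l(4)[of t] L1ge[of t] assms(1-4) unfolding L_def by auto
    qed
    \<comment> \<open>During the rest the characteristic is \<open>t - b\<close>, hence the shift of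
      \<open>N'\<close> by \<open>b\<close>; the remaining points are the ends of the three
      phases.\<close>
    define Z where "Z = N \<union> (\<lambda>x. x + b) ` N' \<union> {0, s, T - b, T}"
    have "negligible ((\<lambda>x. x + b) ` N')"
      by (rule negligible_lipschitz_image[of 1 UNIV, OF _ N']) (auto intro!: lipschitz_onI simp: dist_real_def)
    then have Z: "negligible Z" using N by (simp add: Z_def)
    have "\<exists>d. (F has_real_derivative d) (at (t - L t)) \<and> (L has_real_derivative front_speed d (\<kappa> (L t))) (at t)"
      if t: "t \<in> {0..T} - Z" for t
    proof -
      consider "t \<in> {0<..<s}" | "t \<in> {s<..<T - b}" | "t \<in> {T - b<..<T}"
        using t by (fastforce simp: Z_def)
      then show ?thesis
      proof cases
        case 1
        then have Lt: "L t = l t" by (simp add: L_def)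
        have "t \<in> {0<..<s} - N" using 1 t by (auto simp: Z_def)
        then obtain d where th: "t - l t \<in> {-l0<..<0}" and d: "(f has_real_derivative d) (at (t - l t))"
            "(l has_real_derivative front_speed d (\<kappa> (l t))) (at t)" using ode by blast
        have "(F has_real_derivative d) (at (t - l t))"
          by (rule has_field_derivative_transform_within_open[OF d(1), of "{-l0<..<0}"])
             (use th in \<open>auto simp: F_def\<close>)
        moreover have "(L has_real_derivative front_speed d (\<kappa> (l t))) (at t)"
          by (rule has_field_derivative_transform_within_open[OF d(2), of "{0<..<s}"])
             (use 1 in \<open>auto simp: L_def\<close>)
        ultimately show ?thesis unfolding Lt by blast
      next
        case 2
        then have Lt: "L t = L1 t" by (simp add: L_def)
        define x where "x = t - L1 t"
        have "0 < x" using 2 m by (simp add: x_def L1\<theta>(1))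
        moreover have "x < S"
        proof -
          have "t - s < S * (1 + m)" using 2 Sm by (simp add: algebra_simps)
          then show ?thesis using m by (simp add: x_def L1\<theta>(1) divide_less_eq)
        qed
        ultimately have x: "x \<in> {0<..<S}" by simp
        have "at x within {0..S} = at x" using x by (simp add: at_within_Icc_at)
        then have "(f1 has_real_derivative h x) (at x)" using f1d[of x] x by simp
        then have "(F has_real_derivative h x) (at x)"
          by (rule has_field_derivative_transform_within_open[of _ _ _ "{0<..<S}"])
             (use x in \<open>auto simp: F_def\<close>)
        moreover have "(L has_real_derivative m / (1 + m)) (at t)"
        proof (rule has_field_derivative_transform_within_open[of L1 _ _ "{s<..<T - b}"])
          show "(L1 has_real_derivative m / (1 + m)) (at t)"
            unfolding L1_def using m by (auto intro!: derivative_eq_intros)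
        qed (use 2 in \<open>auto simp: L_def\<close>)
        moreover have "front_speed (h x) (\<kappa> (L1 t)) = m / (1 + m)"
        proof -
          have k: "0 < \<kappa> (L1 t)" using L1ge[of t] 2 \<open>0 < s\<close> by (intro pos) auto
          have "2 * (h x)\<^sup>2 = \<kappa> (L1 t) * (1 + 2 * m)"
            using k m L1\<theta>(2)[of t] by (simp add: h_def x_def)
          then have "front_speed (h x) (\<kappa> (L1 t)) = max ((\<kappa> (L1 t) * (2 * m)) / (\<kappa> (L1 t) * (2 * (1 + m)))) 0"
            by (simp add: front_speed_def algebra_simps)
          also have "(\<kappa> (L1 t) * (2 * m)) / (\<kappa> (L1 t) * (2 * (1 + m))) = (2 * m) / (2 * (1 + m))"
            using k by (intro mult_divide_mult_cancel_left) simp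
          also have "\<dots> = m / (1 + m)" by (rule mult_divide_mult_cancel_left) simp
          also have "max \<dots> 0 = m / (1 + m)" using m by simp
          finally show ?thesis .
        qed
        ultimately show ?thesis unfolding Lt x_def by metis
      next
        case 3
        then have Lt: "L t = b" using assms(1-4) by (simp add: L_def)
        have x: "t - b \<in> {T - 2 * b<..<T - b}" using 3 by auto
        have "t - b \<notin> N'" using t by (force simp: Z_def)
        then obtain d where d: "(\<phi> has_real_derivative d) (at (t - b))" "2 * d\<^sup>2 \<le> \<kappa> b"
          using der\<phi>[of "t - b"] x by blast
        have "((\<lambda>x. \<phi> x + c) has_real_derivative d) (at (t - b))" using d(1) by (auto intro!: derivative_eq_intros)
        then have "(F has_real_derivative d) (at (t - b))"
          by (rule has_field_derivative_transform_within_open[of _ _ _ "{S<..<T - b}"])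
             (use x S in \<open>auto simp: F_def S_def\<close>)
        moreover have "(L has_real_derivative 0) (at t)"
        proof (rule has_field_derivative_transform_within_open[of "\<lambda>_. b" _ _ "{T - b<..<T}"])
        qed (use 3 assms(1-4) in \<open>auto simp: L_def\<close>)
        moreover have "front_speed d (\<kappa> b) = 0"
        proof -
          have "0 < \<kappa> b" using assms(1-4) by (intro pos) auto
          then have "(2 * d\<^sup>2 - \<kappa> b) / (2 * d\<^sup>2 + \<kappa> b) \<le> 0" using d(2) by (intro divide_nonpos_pos) (auto intro: add_nonneg_pos)
          then show ?thesis by (simp add: front_speed_def)
        qed
        ultimately show ?thesis unfolding Lt by metis
      qed
    qed
    then show "\<exists>N. negligible N \<and> (\<forall>t\<in>{0..T} - N. \<exists>d. (F has_real_derivative d) (at (t - L t) within {-l0..T}) \<and>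
        (L has_real_derivative front_speed d (\<kappa> (L t))) (at t within {0..T}))"
      using Z has_field_derivative_at_within by metis
  qed
  moreover have "F x = \<phi> x + c" if "x \<in> {T - 2 * b..T}" for x
    using that S by (cases "x = S") (auto simp: F_def S_def c_def)
  moreover have "L t = b" if "t \<in> {T - b..T}" for t
    using that assms(1-4) L1end by (cases "t = T - b") (auto simp: L_def)
  ultimately show ?thesis using that[of F L c] by (simp add: F_def)
qed

end

section \<open>Steering to the target state\<close>

theorem corollary4p6:
  fixes \<kappa> y0 y1 yb0 yb1 :: "real \<Rightarrow> real"
    and c1 c2 l0 lstar T lb0 :: real
  assumes "0 < c1" and "c1 < c2"
    and "\<forall>x\<ge>0. c1 \<le> \<kappa> x \<and> \<kappa> x \<le> c2"
    and "local_lipschitz (UNIV :: real set) {0..} (\<lambda>_. \<kappa>)"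
    and "0 < l0"
    and "C01_on {0..l0} y0" and "Linf_on 0 l0 y1"
    and "y0 l0 = 0"
    and "initial_branch_end \<kappa> l0 y0 y1 lstar"
    and "0 < T" and "0 < lb0"
    and "C1_on 0 lb0 yb0" and "continuous_on {0..lb0} yb1"
    and "lb0 \<ge> lstar"
    and "T > 2 * lb0"
    and "yb0 lb0 = 0"
    and "(Linf_norm 0 lb0 (\<lambda>x. yb1 x + D_on 0 lb0 yb0 x))\<^sup>2 \<le> ereal (2 * \<kappa> lb0)"
  shows "\<exists>u. C01_on {0..T} u \<and> u 0 = y0 0 \<and>
           (\<exists>l y. C01_solution \<kappa> l0 y0 y1 T u l y) \<and>
           (\<forall>l y. C01_solution \<kappa> l0 y0 y1 T u l y \<longrightarrow>
              l T = lb0 \<and>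
              (\<forall>x\<in>{0..lb0}. y T x = yb0 x) \<and>
              (AE x\<in>{0..lb0} in lebesgue.
                 ((\<lambda>t. y t x) has_real_derivative yb1 x) (at_left T)))"
proof -
  interpret toughness \<kappa> c1 by unfold_locales (use assms in auto)
  define D where "D = D_on 0 l0 y0"
  define f0 where "f0 = (\<lambda>x. 1/2 * (y0 (-x) - y0 0 - integral {0..-x} y1))"
  obtain li N where li: "0 < lstar" "C01_on {0..lstar} li" "li 0 = l0" "li lstar = lstar"
    "\<And>t. t \<in> {0..lstar} \<Longrightarrow> l0 \<le> li t" and N: "negligible N"
    and ode: "\<And>t. t \<in> {0<..<lstar} - N \<Longrightarrow> t - li t \<in> {-l0<..<0} \<and>
       (\<exists>d. (f0 has_real_derivative d) (at (t - li t)) \<and>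
            (li has_real_derivative front_speed d (\<kappa> (li t))) (at t))"
    and D: "D integrable_on {0..l0}" "\<And>x. x \<in> {0..l0} \<Longrightarrow> integral {0..x} D = y0 x - y0 0"
    by (rule initial_branch[OF \<open>initial_branch_end \<kappa> l0 y0 y1 lstar\<close> \<open>0 < l0\<close> \<open>C01_on {0..l0} y0\<close> \<open>Linf_on 0 l0 y1\<close>,
          folded f0_def D_def], rule that)
  have "l0 \<le> lstar" using li(5)[of lstar] li(1,4) by simp
  have lT: "lstar \<le> lb0" "2 * lb0 < T" "l0 \<le> lb0" using assms \<open>l0 \<le> lstar\<close> by auto
  have iy1: "y1 integrable_on {0..l0}" using Linf_on_integrable assms by blast
  obtain A where A: "A-lipschitz_on {0..l0} y0" using assms by (auto simp: C01_on_def)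
  obtain B where B: "B-lipschitz_on {0..l0} (\<lambda>x. integral {0..x} y1)"
    using Linf_on_bounded_AE[OF \<open>Linf_on 0 l0 y1\<close>] lipschitz_on_indefinite_integral[OF iy1] by metis
  have f0C: "C01_on {-l0..0} f0"
  proof -
    have "(A * 1)-lipschitz_on {-l0..0} (\<lambda>x. y0 (- x))" "(B * 1)-lipschitz_on {-l0..0} (\<lambda>x. integral {0..-x} y1)"
      using lipschitz_on_compose2[OF lipschitz_on_uminus[of "{-l0..0}"]] A B by auto
    note lipschitz_on_cmult_real[OF lipschitz_on_diff[OF lipschitz_on_diff[OF this(1) lipschitz_on_constant] this(2)]]
    then show ?thesis unfolding C01_on_def f0_def by blast
  qed
  define S where "S = T - 2 * lb0"
  define Db where "Db = D_on 0 lb0 yb0"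
  define q where "q x = integral {0..x} yb1" for x
  \<comment> \<open>\<open>f\<close> along the characteristics that reach time \<open>T\<close> after (\<open>a\<close>) and without (\<open>b\<close>) reflection at the front\<close>
  define a where "a x = - (1/2) * yb0 x - 1/2 * q x" for x
  define b where "b x = 1/2 * yb0 x - 1/2 * q x" for x
  \<comment> \<open>With the front at rest at \<open>lb0\<close>, the final displacement is
    \<open>b - a\<close> and the final velocity is \<open>- (a' + b')\<close>; \<open>a\<close> and
    \<open>b\<close> solve these two equations for the target. The pieces of \<open>\<phi>\<close>
    join at \<open>T - lb0\<close> because \<open>yb0 lb0 = 0\<close>.\<close>
  define \<phi> where "\<phi> x = (if x \<le> T - lb0 then a (x - S) else b (T - x))" for x
  have dyb: "(yb0 has_real_derivative Db x) (at x within {0..lb0})" if "x \<in> {0..lb0}" for x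
    unfolding Db_def using C1_on_has_real_derivative assms that by blast
  have dq: "(q has_real_derivative yb1 x) (at x within {0..lb0})" if "x \<in> {0..lb0}" for x
    unfolding q_def using integral_has_real_derivative[OF \<open>continuous_on {0..lb0} yb1\<close> that] .
  have cDb: "continuous_on {0..lb0} Db" using assms by (simp add: Db_def C1_on_def)
  have da: "(a has_real_derivative - (1/2) * Db x - 1/2 * yb1 x) (at x within {0..lb0})"
    and db: "(b has_real_derivative 1/2 * Db x - 1/2 * yb1 x) (at x within {0..lb0})" if "x \<in> {0..lb0}" for x
    unfolding a_def b_def by (intro DERIV_diff DERIV_cmult dyb[OF that] dq[OF that])+
  have at: "at x within {0..lb0} = at x" if "x \<in> {0<..<lb0}" for x using that by (simp add: at_within_Icc_at)
  obtain Ka Kb where Ka: "Ka-lipschitz_on {0..lb0} a" and Kb: "Kb-lipschitz_on {0..lb0} b"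
  proof -
    have "continuous_on {0..lb0} (\<lambda>x. - (1/2) * Db x - 1/2 * yb1 x)"
      "continuous_on {0..lb0} (\<lambda>x. 1/2 * Db x - 1/2 * yb1 x)"
      by (intro continuous_intros cDb \<open>continuous_on {0..lb0} yb1\<close>)+
    then show ?thesis using C1_imp_lipschitz[OF da] C1_imp_lipschitz[OF db] that by blast
  qed
  have ab: "a lb0 = b lb0" using \<open>yb0 lb0 = 0\<close> by (simp add: a_def b_def)
  have \<phi>C: "C01_on {T - 2 * lb0..T} \<phi>"
    unfolding C01_on_def \<phi>_def
  proof (rule exI, rule lipschitz_on_concat_max)
    show "(Ka * 1)-lipschitz_on {T - 2 * lb0..T - lb0} (\<lambda>x. a (x - S))"
      by (rule lipschitz_on_compose2[OF _ lipschitz_on_subset[OF Ka]])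
         (auto intro!: lipschitz_onI simp: dist_real_def S_def)
    show "(Kb * 1)-lipschitz_on {T - lb0..T} (\<lambda>x. b (T - x))"
      by (rule lipschitz_on_compose2[OF _ lipschitz_on_subset[OF Kb]])
         (auto intro!: lipschitz_onI simp: dist_real_def)
    show "a (T - lb0 - S) = b (T - (T - lb0))" using ab by (simp add: S_def)
  qed
  \<comment> \<open>The derivative of \<open>a\<close> is \<open>- v / 2\<close>, so the norm bound
    on \<open>v\<close> says \<open>2 * (a')\<^sup>2 \<le> \<kappa> lb0\<close> almost everywhere:
    the arriving wave is too weak to move the front.\<close>
  define v where "v = (\<lambda>x. yb1 x + Db x)"
  obtain N3 where N3: "negligible N3" "\<And>x. x \<in> {0..lb0} - N3 \<Longrightarrow> ereal \<bar>v x\<bar> \<le> Linf_norm 0 lb0 v"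
    using Linf_norm_AE[of 0 lb0 v] unfolding AE_lebesgue_on_iff_negligible by blast
  have v: "(v x)\<^sup>2 \<le> 2 * \<kappa> lb0" if "x \<in> {0..lb0} - N3" for x
  proof -
    have le: "(Linf_norm 0 lb0 v)\<^sup>2 \<le> ereal (2 * \<kappa> lb0)" using assms by (simp add: v_def Db_def)
    show ?thesis
    proof (cases "Linf_norm 0 lb0 v")
      case (real r)
      then have "\<bar>v x\<bar> \<le> r" and r: "r\<^sup>2 \<le> 2 * \<kappa> lb0"
        using N3(2)[OF that] le by (simp_all add: power2_eq_square)
      then have "\<bar>v x\<bar>\<^sup>2 \<le> r\<^sup>2" by (intro power_mono) auto
      then show ?thesis using r by simp
    qed (use N3(2)[OF that] le in \<open>simp_all add: power2_eq_square\<close>)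
  qed
  define N' where "N' = (\<lambda>x. x + S) ` N3"
  have N': "negligible N'"
    unfolding N'_def
    by (rule negligible_lipschitz_image[of 1 UNIV, OF _ N3(1)]) (auto intro!: lipschitz_onI simp: dist_real_def)
  have der\<phi>: "\<exists>d. (\<phi> has_real_derivative d) (at x) \<and> 2 * d\<^sup>2 \<le> \<kappa> lb0"
    if x: "x \<in> {T - 2 * lb0<..<T - lb0} - N'" for x
  proof -
    define z where "z = x - S"
    have z: "z \<in> {0<..<lb0}" "z \<notin> N3" using x by (auto simp: z_def S_def N'_def image_iff)
    have "(a has_real_derivative - (1/2) * Db z - 1/2 * yb1 z) (at z)"
      using da[of z] at[OF z(1)] z by simp
    moreover have "- (1/2) * Db z - 1/2 * yb1 z = - (1/2) * v z" by (simp add: v_def add_divide_distrib)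
    ultimately have "(a has_real_derivative - (1/2) * v z) (at z)" by (simp only:)
    then have "((\<lambda>x. a (x - S)) has_real_derivative - (1/2) * v z) (at x)"
      using DERIV_shift[of a "- (1/2) * v z" x "- S"] by (simp add: z_def)
    then have "(\<phi> has_real_derivative - (1/2) * v z) (at x)"
      by (rule has_field_derivative_transform_within_open[of _ _ _ "{T - 2 * lb0<..<T - lb0}"])
         (use x in \<open>auto simp: \<phi>_def\<close>)
    moreover have "2 * (- (1/2) * v z)\<^sup>2 \<le> \<kappa> lb0" using v[of z] z by (simp add: power2_eq_square)
    ultimately show ?thesis by blast
  qed
  have li0: "0 < li t" if "t \<in> {0..lstar}" for t using li(5)[OF that] \<open>0 < l0\<close> by simp
  obtain F L c where F: "front l0 T F L" and Ff0: "\<And>x. x \<in> {-l0..0} \<Longrightarrow> F x = f0 x"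
    and F\<phi>: "\<And>x. x \<in> {T - 2 * lb0..T} \<Longrightarrow> F x = \<phi> x + c" and Lb: "\<And>t. t \<in> {T - lb0..T} \<Longrightarrow> L t = lb0"
  proof (rule front_steering)
    show "0 < l0" "0 < lstar" "lstar \<le> lb0" "2 * lb0 < T" "C01_on {0..lstar} li" "li 0 = l0" "li lstar = lstar"
      "C01_on {-l0..0} f0" "negligible N" "C01_on {T - 2 * lb0..T} \<phi>" "negligible N'" by fact+
    show "f0 0 = 0" by (simp add: f0_def)
  qed (use li0 ode der\<phi> in auto)
  have int: "integral {0..x} (\<lambda>\<sigma>. D \<sigma> - y1 \<sigma>) = y0 x - y0 0 - integral {0..x} y1"
    "integral {0..x} (\<lambda>\<sigma>. D \<sigma> + y1 \<sigma>) = y0 x - y0 0 + integral {0..x} y1" if x: "x \<in> {0..l0}" for x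
  proof -
    have "D integrable_on {0..x}" "y1 integrable_on {0..x}"
      using D(1) iy1 x by (auto intro: integrable_on_subinterval)
    then show "integral {0..x} (\<lambda>\<sigma>. D \<sigma> - y1 \<sigma>) = y0 x - y0 0 - integral {0..x} y1"
      "integral {0..x} (\<lambda>\<sigma>. D \<sigma> + y1 \<sigma>) = y0 x - y0 0 + integral {0..x} y1"
      using D(2)[OF x]
      by (simp_all add: Henstock_Kurzweil_Integration.integral_diff Henstock_Kurzweil_Integration.integral_add)
  qed
  obtain u y where u: "C01_on {0..T} u" "u 0 = y0 0" and sol: "C01_solution \<kappa> l0 y0 y1 T u L y"
    and y: "\<And>t x. t \<in> {0..T} \<Longrightarrow> x \<in> {0..L t} \<Longrightarrow> l0 < t + x \<Longrightarrow> y t x = F (t - x) - F (reflect T L (t + x))"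
  proof (rule front_imp_C01_solution[OF F \<open>0 < l0\<close>])
    show "l0 < T" using lT \<open>0 < l0\<close> by simp
    show "F s = 1/2 * integral {0..-s} (\<lambda>\<sigma>. D_on 0 l0 y0 \<sigma> - y1 \<sigma>)" if "s \<in> {-l0..0}" for s
      using Ff0[OF that] int(1)[of "-s"] that by (simp add: f0_def D_def)
    have "(A + 0 + B)-lipschitz_on {0..l0} (\<lambda>x. y0 x - y0 0 + integral {0..x} y1)"
      by (rule lipschitz_on_add[OF lipschitz_on_diff[OF A lipschitz_on_constant] B])
    then have "(A + 0 + B)-lipschitz_on {0..l0} (\<lambda>x. integral {0..x} (\<lambda>\<sigma>. D_on 0 l0 y0 \<sigma> + y1 \<sigma>))"
      by (rule lipschitz_on_transform) (use int(2) in \<open>auto simp: D_def\<close>)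
    then show "C01_on {0..l0} (\<lambda>x. integral {0..x} (\<lambda>\<sigma>. D_on 0 l0 y0 \<sigma> + y1 \<sigma>))" unfolding C01_on_def by blast
    show "F (-l0) = - y0 0 - 1/2 * integral {0..l0} (\<lambda>\<sigma>. D_on 0 l0 y0 \<sigma> + y1 \<sigma>)"
      using Ff0[of "-l0"] int(2)[of l0] \<open>0 < l0\<close> \<open>y0 l0 = 0\<close> by (simp add: f0_def D_def field_simps)
  qed (rule that)
  have "0 < T" using assms by simp
  note FF = F \<open>0 < T\<close> \<open>0 < l0\<close>
  \<comment> \<open>The representation is needed on a region of times before \<open>T\<close>, not
    only at \<open>T\<close>, because the target velocity is a left derivative in
    \<open>t\<close>.\<close>
  have final: "y t x = b (T - t + x) - a (t + x - T)"
    if t: "t \<in> {T - lb0..T}" and x: "x \<in> {0..lb0}" and "T \<le> t + x" "T - lb0 \<le> t - x" for t x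
  proof -
    have t': "t + x - lb0 \<in> {T - lb0..T}" using that by auto
    have "reflect T L (t + x) = t + x - 2 * lb0"
      using reflect_front[OF FF, of "t + x - lb0"] Lb[OF t'] t' lT \<open>0 < l0\<close> by simp
    moreover have "y t x = F (t - x) - F (reflect T L (t + x))"
      by (rule y) (use that Lb[OF t] lT \<open>0 < l0\<close> in auto)
    \<comment> \<open>At the joint \<open>t - x = T - lb0\<close> the definition of
      \<open>\<phi>\<close> selects \<open>a\<close>; the value agrees with \<open>b\<close> there
      by \<open>ab\<close>.\<close>
    moreover have "\<phi> (t - x) = b (T - t + x)"
    proof (cases "t - x = T - lb0")
      case True
      then have "t - x - S = lb0" "T - t + x = lb0" by (simp_all add: S_def)
      moreover have "\<phi> (t - x) = a (t - x - S)" using True by (simp add: \<phi>_def)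
      ultimately show ?thesis using ab by (simp only:)
    next
      case False
      then have "\<phi> (t - x) = b (T - (t - x))" using that by (simp add: \<phi>_def)
      moreover have "T - (t - x) = T - t + x" by simp
      ultimately show ?thesis by (simp only:)
    qed
    moreover have "\<phi> (t + x - 2 * lb0) = a (t + x - T)"
    proof -
      have "\<phi> (t + x - 2 * lb0) = a (t + x - 2 * lb0 - S)" using that by (simp add: \<phi>_def)
      moreover have "t + x - 2 * lb0 - S = t + x - T" by (simp add: S_def)
      ultimately show ?thesis by (simp only:)
    qed
    moreover have "F (t - x) = \<phi> (t - x) + c" "F (t + x - 2 * lb0) = \<phi> (t + x - 2 * lb0) + c"
      using that lT by (auto intro!: F\<phi>)
    ultimately show ?thesis by (simp only: add_diff_cancel_right)
  qed
  show ?thesis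
  proof (rule exI[of _ u], intro conjI allI impI)
    show "C01_on {0..T} u" "u 0 = y0 0" by fact+
    show "\<exists>l y. C01_solution \<kappa> l0 y0 y1 T u l y" using sol by blast
    \<comment> \<open>Any solution for this control coincides with the constructed one, so the
      target conditions can be read off from \<open>final\<close>.\<close>
    fix l' y' assume sol': "C01_solution \<kappa> l0 y0 y1 T u l' y'"
    note uniq = C01_solution_unique[OF sol' sol \<open>0 < T\<close> \<open>0 < l0\<close>]
    have l': "l' t = lb0" if "t \<in> {T - lb0..T}" for t
      using uniq(1)[of t] Lb[OF that] that lT \<open>0 < l0\<close> by simp
    then show "l' T = lb0" using \<open>0 < lb0\<close> by simp
    have final': "y' t x = b (T - t + x) - a (t + x - T)"
      if "t \<in> {T - lb0..T}" "x \<in> {0..lb0}" "T \<le> t + x" "T - lb0 \<le> t - x" for t x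
      using uniq(2)[of t x] l'[OF that(1)] final[OF that] that lT \<open>0 < l0\<close> by simp
    show "\<forall>x\<in>{0..lb0}. y' T x = yb0 x"
      using final'[of T] \<open>0 < lb0\<close> by (simp add: a_def b_def)
    have "((\<lambda>t. y' t x) has_real_derivative yb1 x) (at_left T)" if x: "x \<in> {0<..<lb0}" for x
    proof -
      have "(b has_real_derivative 1/2 * Db x - 1/2 * yb1 x) (at (T - T + x))"
        "(a has_real_derivative - (1/2) * Db x - 1/2 * yb1 x) (at (T + x - T))"
        using da[of x] db[of x] at[OF x] x by simp_all
      then have "((\<lambda>t. b (T - t + x) - a (t + x - T)) has_real_derivative yb1 x) (at T)"
        by (auto intro!: derivative_eq_intros DERIV_chain2[of b] DERIV_chain2[of a])
      then have "((\<lambda>t. b (T - t + x) - a (t + x - T)) has_real_derivative yb1 x) (at T within {..T})"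
        by (rule has_field_derivative_at_within)
      then have "((\<lambda>t. y' t x) has_real_derivative yb1 x) (at T within {..T})"
      proof (rule has_field_derivative_transform_within)
        \<comment> \<open>For \<open>T - t\<close> at most \<open>x\<close> and at most
          \<open>lb0 - x\<close>, the point \<open>(t, x)\<close> stays in the region of
          \<open>final'\<close>.\<close>
        show "0 < min x (lb0 - x)" using x by simp
        fix t assume "t \<in> {..T}" "dist t T < min x (lb0 - x)"
        then show "b (T - t + x) - a (t + x - T) = y' t x"
          using x by (intro final'[symmetric]) (auto simp: dist_real_def)
      qed auto
      then show ?thesis by (rule has_field_derivative_subset) auto
    qed
    then show "AE x\<in>{0..lb0} in lebesgue. ((\<lambda>t. y' t x) has_real_derivative yb1 x) (at_left T)"
      unfolding AE_lebesgue_on_iff_negligible by (intro exI[of _ "{0, lb0}"]) auto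
  qed
qed

end
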